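(* Let $\mathfrak{A}$ be a unital C*-algebra, $\mathfrak{H}$ a Hilbert $\mathfrak{A}$-module, $\omega:=(\omega_n)_{n\in\mathbb{N}^*}$ a weight of $\mathfrak{A}$, and $(\mathfrak{H}_n)_{n\in\mathbb{N}^*},(\mathfrak{K}_n)_{n\in\mathbb{N}^*}\in\mathfrak{Comp}(\mathfrak{H})^{\mathbb{N}^*}$. Assume that $((\mathfrak{H}_n,\omega_n))_{n\in\mathbb{N}^*}$ is a *-fusion frame of $\mathfrak{H}$ of lower bound $A\in\mathfrak{A}$. 1. If $$\sum_{n=1}^{+\infty}\|\omega_n\|_{\mathfrak{A}}^2\,\widehat{(\mathfrak{H}_n,\mathfrak{K}_n)}^{\,2}<\|A^{-1}\|_{\mathfrak{A}}^{-2},$$ then $((\mathfrak{K}_n,\omega_n))_{n\in\mathbb{N}^*}$ is a *-fusion frame of $\mathfrak{H}$. 2. Assume that the sequence $\omega$ is bounded. If $$\sum_{n=1}^{+\infty}\widehat{(\mathfrak{H}_n,\mathfrak{K}_n)}^{\,2}<\left(\frac{\|A^{-1}\|_{\mathfrak{A}}^{-1}}{\|\omega\|_\infty}\right)^2,$$ then $((\mathfrak{K}_n,\omega_n))_{n\in\mathbb{N}^*}$ is a *-fusion frame of $\mathfrak{H}$. 3. Assume that there is a real constant $p\in\,]1,+\infty[$ such that the sequence $\mathfrak{q}(\omega)$ belongs to $l_p(\mathbb{C})$. If $$\sum_{n=1}^{+\infty}\widehat{(\mathfrak{H}_n,\mathfrak{K}_n)}^{\,\frac{2p}{p-1}}<\left(\frac{\|A^{-1}\|_{\mathfrak{A}}^{-2}}{\|\mathfrak{q}(\omega)\|_p}\right)^{\frac{p}{p-1}},$$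 then $((\mathfrak{K}_n,\omega_n))_{n\in\mathbb{N}^*}$ is a *-fusion frame of $\mathfrak{H}$.
   Context: $\mathbb{N}^*=\{1,2,3,\dots\}$. Hilbert $\mathfrak{A}$-modules are left modules with $\mathfrak{A}$-valued inner product $\langle\cdot,\cdot\rangle$ that is $\mathfrak{A}$-linear in the first variable; $|x|:=\langle x,x\rangle^{1/2}\in\mathfrak{A}$ and $\|x\|_{\mathfrak{H}}:=\||x|\|_{\mathfrak{A}}$. For $a,b\in\mathfrak{A}$, $a\preccurlyeq b$ means that $b-a$ is positive. An element of $\mathfrak{A}$ is strictly positive if every nonzero positive linear form takes a value $>0$ on it; since $\mathfrak{A}$ is unital this is equivalent to being positive and invertible. A closed submodule $\mathfrak{K}$ of $\mathfrak{H}$ is orthogonally complemented if $\mathfrak{H}=\mathfrak{K}\oplus\mathfrak{K}^\perp$, where $\mathfrak{K}^\perp=\{u\in\mathfrak{H}:\langle u,x\rangle=0\ \forall x\in\mathfrak{K}\}$; $P_{\mathfrak{K}}$ denotes the corresponding orthogonal projection of $\mathfrak{H}$ onto $\mathfrak{K}$. $\mathfrak{Comp}(\mathfrak{H})$ is the set of all orthogonally complemented submodules of $\mathfrak{H}$, and $\mathfrak{Comp}(\mathfrak{H})^{\mathbb{N}^*}$ the set of sequences in it. A weight of $\mathfrak{A}$ is a sequence $(\omega_n)_{n\in\mathbb{N}^*}$ of central and strictly positive elements of $\mathfrak{A}$. Given $(\mathfrak{H}_n)_{n\in\mathbb{N}^*}\in\mathfrak{Comp}(\mathfrak{H})^{\mathbb{N}^*}$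 and a weight $(\omega_n)_{n\in\mathbb{N}^*}$, the sequence $((\mathfrak{H}_n,\omega_n))_{n\in\mathbb{N}^*}$ is a *-fusion frame of $\mathfrak{H}$ if for each $x\in\mathfrak{H}$ the series $\sum\omega_n^2|P_{\mathfrak{H}_n}(x)|^2$ converges in the norm of $\mathfrak{A}$ and there exist two strictly positive elements $A,B$ of $\mathfrak{A}$ such that $|Ax|^2\preccurlyeq\sum_{n=1}^{+\infty}\omega_n^2|P_{\mathfrak{H}_n}(x)|^2\preccurlyeq|Bx|^2$ for all $x\in\mathfrak{H}$; such $A$ and $B$ are called respectively a lower and an upper bound. For $U,V\in\mathfrak{Comp}(\mathfrak{H})$, $\mathfrak{d}(U,V):=\|P_U-P_V\|$ (operator norm); it is known that $\mathfrak{d}(U,V)\le1$, and the angle between $U$ and $V$ is $\widehat{(U,V)}:=\arcsin(\mathfrak{d}(U,V))\in[0,\pi/2]$. $\|\omega\|_\infty:=\sup_{n\in\mathbb{N}^*}\|\omega_n\|_{\mathfrak{A}}$; $\mathfrak{q}(\omega):=(\|\omega_n\|_{\mathfrak{A}}^2)_{n\in\mathbb{N}^*}$; $l_p(\mathbb{C})$ is the space of $p$-summable complex sequences with norm $\|z\|_p=(\sum_{n}|z_n|^p)^{1/p}$. *)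

theory Defs
  imports "HOL-Analysis.Analysis"
begin

text \<open>
  Unital C*-algebras. The zero algebra is excluded, because \<^class>\<open>real_normed_algebra_1\<close> demands
  that the unit has norm one; there \<open>\<parallel>A\<^sup>-\<^sup>1\<parallel>\<^sup>-\<^sup>1\<close> would have no meaning anyway.
\<close>

class unital_cstar_algebra = real_normed_algebra_1 + banach +
  fixes scaleC :: "complex \<Rightarrow> 'a \<Rightarrow> 'a"
    and star :: "'a \<Rightarrow> 'a"
  assumes scaleC_add_right: "scaleC c (a + b) = scaleC c a + scaleC c b"
    and scaleC_add_left: "scaleC (c + d) a = scaleC c a + scaleC d a"
    and scaleC_scaleC: "scaleC c (scaleC d a) = scaleC (c * d) a"
    and scaleC_of_real: "scaleC (complex_of_real r) a = r *\<^sub>R a"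
    and scaleC_mult_left: "scaleC c a * b = scaleC c (a * b)"
    and scaleC_mult_right: "a * scaleC c b = scaleC c (a * b)"
    and norm_scaleC: "norm (scaleC c a) = cmod c * norm a"
    and star_star: "star (star a) = a"
    and star_add: "star (a + b) = star a + star b"
    and star_scaleC: "star (scaleC c a) = scaleC (cnj c) (star a)"
    and star_mult: "star (a * b) = star b * star a"
    and cstar_identity: "norm (star a * a) = (norm a)\<^sup>2"

definition is_inverse :: "'a::monoid_mult \<Rightarrow> 'a \<Rightarrow> bool" where
  "is_inverse a b \<longleftrightarrow> a * b = 1 \<and> b * a = 1"

definition alg_inverse :: "'a::monoid_mult \<Rightarrow> 'a" where
  "alg_inverse a = (THE b. is_inverse a b)"

definition alg_spectrum :: "'a::unital_cstar_algebra \<Rightarrow> complex set" where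
  "alg_spectrum a = {c. \<not> (\<exists>b. is_inverse (scaleC c 1 - a) b)}"

definition cstar_positive :: "'a::unital_cstar_algebra \<Rightarrow> bool" where
  "cstar_positive a \<longleftrightarrow> star a = a \<and> alg_spectrum a \<subseteq> \<real>\<^sub>\<ge>\<^sub>0"

definition cstar_le :: "'a::unital_cstar_algebra \<Rightarrow> 'a \<Rightarrow> bool" where
  "cstar_le a b \<longleftrightarrow> cstar_positive (b - a)"

definition cstar_sqrt :: "'a::unital_cstar_algebra \<Rightarrow> 'a" where
  "cstar_sqrt a = (THE b. cstar_positive b \<and> b\<^sup>2 = a)"

definition positive_form :: "('a::unital_cstar_algebra \<Rightarrow> complex) \<Rightarrow> bool" where
  "positive_form f \<longleftrightarrow>
     (\<forall>a b. f (a + b) = f a + f b) \<and> (\<forall>c a. f (scaleC c a) = c * f a) \<and>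
     (\<forall>a. cstar_positive a \<longrightarrow> f a \<in> \<real>\<^sub>\<ge>\<^sub>0)"

definition strictly_positive :: "'a::unital_cstar_algebra \<Rightarrow> bool" where
  "strictly_positive a \<longleftrightarrow>
     (\<forall>f. positive_form f \<and> (\<exists>b. f b \<noteq> 0) \<longrightarrow> f a \<in> \<real> \<and> Re (f a) > 0)"

definition central :: "'a::monoid_mult \<Rightarrow> bool" where
  "central a \<longleftrightarrow> (\<forall>b. a * b = b * a)"

definition module_abs :: "('h \<Rightarrow> 'h \<Rightarrow> 'a::unital_cstar_algebra) \<Rightarrow> 'h \<Rightarrow> 'a" where
  "module_abs ip x = cstar_sqrt (ip x x)"

text \<open>
  Left Hilbert modules: \<open>act\<close> is the action of the algebra and \<open>ip\<close> the inner product. Completeness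
  comes from the sort \<open>banach\<close>, whose norm is tied to \<open>ip\<close> by \<open>norm_eq\<close>. The complex scalar
  multiplication is \<open>act (scaleC c 1)\<close>; \<open>scaleR_eq\<close> makes the real one of the type agree with it.
\<close>

locale hilbert_module =
  fixes act :: "'a::unital_cstar_algebra \<Rightarrow> 'h::banach \<Rightarrow> 'h"
    and ip :: "'h \<Rightarrow> 'h \<Rightarrow> 'a"
  assumes smult_add_right: "act a (x + y) = act a x + act a y"
    and smult_add_left: "act (a + b) x = act a x + act b x"
    and smult_smult: "act a (act b x) = act (a * b) x"
    and smult_one: "act 1 x = x"
    and scaleR_eq: "r *\<^sub>R x = act (r *\<^sub>R 1) x"
    and ip_add_left: "ip (x + y) z = ip x z + ip y z"
    and ip_smult_left: "ip (act a x) y = a * ip x y"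
    and ip_star: "ip y x = star (ip x y)"
    and ip_positive: "cstar_positive (ip x x)"
    and ip_definite: "ip x x = 0 \<Longrightarrow> x = 0"
    and norm_eq: "norm x = norm (module_abs ip x)"

definition closed_submodule :: "('a \<Rightarrow> 'h::real_normed_vector \<Rightarrow> 'h) \<Rightarrow> 'h set \<Rightarrow> bool" where
  "closed_submodule act K \<longleftrightarrow>
     0 \<in> K \<and> (\<forall>x\<in>K. \<forall>y\<in>K. x + y \<in> K) \<and> (\<forall>a. \<forall>x\<in>K. act a x \<in> K) \<and> closed K"

definition orth_compl :: "('h \<Rightarrow> 'h \<Rightarrow> 'a::zero) \<Rightarrow> 'h set \<Rightarrow> 'h set" where
  "orth_compl ip K = {u. \<forall>x\<in>K. ip u x = 0}"

definition Comp :: "('a \<Rightarrow> 'h::real_normed_vector \<Rightarrow> 'h) \<Rightarrow> ('h \<Rightarrow> 'h \<Rightarrow> 'a::zero) \<Rightarrow> 'h set set" where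
  "Comp act ip =
     {K. closed_submodule act K \<and> K \<inter> orth_compl ip K = {0} \<and>
         (\<forall>x. \<exists>y\<in>K. \<exists>z\<in>orth_compl ip K. x = y + z)}"

definition orth_proj :: "('h \<Rightarrow> 'h \<Rightarrow> 'a::zero) \<Rightarrow> 'h set \<Rightarrow> 'h::ab_group_add \<Rightarrow> 'h" where
  "orth_proj ip K x = (THE y. y \<in> K \<and> x - y \<in> orth_compl ip K)"

definition gap :: "('h \<Rightarrow> 'h \<Rightarrow> 'a::zero) \<Rightarrow> 'h::real_normed_vector set \<Rightarrow> 'h set \<Rightarrow> real" where
  "gap ip U V = onorm (\<lambda>x. orth_proj ip U x - orth_proj ip V x)"

definition angle :: "('h \<Rightarrow> 'h \<Rightarrow> 'a::zero) \<Rightarrow> 'h::real_normed_vector set \<Rightarrow> 'h set \<Rightarrow> real" where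
  "angle ip U V = arcsin (gap ip U V)"

text \<open>
  From here on sequences are indexed from 0, so that the term with index \<open>n\<close> is the \<open>(n+1)\<close>-st one
  of a sequence indexed by the positive integers.
\<close>

definition weight :: "(nat \<Rightarrow> 'a::unital_cstar_algebra) \<Rightarrow> bool" where
  "weight \<omega> \<longleftrightarrow> (\<forall>n. central (\<omega> n) \<and> strictly_positive (\<omega> n))"

definition frame_term ::
    "('h \<Rightarrow> 'h \<Rightarrow> 'a::unital_cstar_algebra) \<Rightarrow> (nat \<Rightarrow> 'h::ab_group_add set) \<Rightarrow> (nat \<Rightarrow> 'a) \<Rightarrow>
     'h \<Rightarrow> nat \<Rightarrow> 'a" where
  "frame_term ip U \<omega> x n = (\<omega> n)\<^sup>2 * (module_abs ip (orth_proj ip (U n) x))\<^sup>2"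

definition fusion_bounds ::
    "('a::unital_cstar_algebra \<Rightarrow> 'h::banach \<Rightarrow> 'h) \<Rightarrow> ('h \<Rightarrow> 'h \<Rightarrow> 'a) \<Rightarrow>
     (nat \<Rightarrow> 'h set) \<Rightarrow> (nat \<Rightarrow> 'a) \<Rightarrow> 'a \<Rightarrow> 'a \<Rightarrow> bool" where
  "fusion_bounds act ip U \<omega> A B \<longleftrightarrow>
     strictly_positive A \<and> strictly_positive B \<and>
     (\<forall>x. cstar_le ((module_abs ip (act A x))\<^sup>2) (\<Sum>n. frame_term ip U \<omega> x n) \<and>
          cstar_le (\<Sum>n. frame_term ip U \<omega> x n) ((module_abs ip (act B x))\<^sup>2))"

definition star_fusion_frame ::
    "('a::unital_cstar_algebra \<Rightarrow> 'h::banach \<Rightarrow> 'h) \<Rightarrow> ('h \<Rightarrow> 'h \<Rightarrow> 'a) \<Rightarrow>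
     (nat \<Rightarrow> 'h set) \<Rightarrow> (nat \<Rightarrow> 'a) \<Rightarrow> bool" where
  "star_fusion_frame act ip U \<omega> \<longleftrightarrow>
     range U \<subseteq> Comp act ip \<and> weight \<omega> \<and> (\<forall>x. summable (frame_term ip U \<omega> x)) \<and>
     (\<exists>A B. fusion_bounds act ip U \<omega> A B)"

definition lower_bound ::
    "('a::unital_cstar_algebra \<Rightarrow> 'h::banach \<Rightarrow> 'h) \<Rightarrow> ('h \<Rightarrow> 'h \<Rightarrow> 'a) \<Rightarrow>
     (nat \<Rightarrow> 'h set) \<Rightarrow> (nat \<Rightarrow> 'a) \<Rightarrow> 'a \<Rightarrow> bool" where
  "lower_bound act ip U \<omega> A \<longleftrightarrow> (\<exists>B. fusion_bounds act ip U \<omega> A B)"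

definition sup_norm :: "(nat \<Rightarrow> 'a::real_normed_vector) \<Rightarrow> real" where
  "sup_norm \<omega> = (SUP n. norm (\<omega> n))"

definition sq_norms :: "(nat \<Rightarrow> 'a::real_normed_vector) \<Rightarrow> nat \<Rightarrow> complex" where
  "sq_norms \<omega> n = complex_of_real ((norm (\<omega> n))\<^sup>2)"

definition lp_space :: "real \<Rightarrow> (nat \<Rightarrow> complex) set" where
  "lp_space p = {z. summable (\<lambda>n. cmod (z n) powr p)}"

definition lp_norm :: "real \<Rightarrow> (nat \<Rightarrow> complex) \<Rightarrow> real" where
  "lp_norm p z = (\<Sum>n. cmod (z n) powr p) powr (1 / p)"

text \<open>
  For series of nonnegative terms, \<open>\<Sum>n. a n < r\<close> includes convergence, which \<^const>\<open>suminf\<close> alone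
  does not express.
\<close>

definition series_less :: "(nat \<Rightarrow> real) \<Rightarrow> real \<Rightarrow> bool" where
  "series_less a r \<longleftrightarrow> summable a \<and> (\<Sum>n. a n) < r"

end

(*
  Write |v|^2 for the A-valued square. With u_n = omega_n P_{H_n} x and v_n = omega_n P_{K_n} x one has
  |v_n - u_n| of norm at most |omega_n| d(H_n, K_n) |x|, and d <= arcsin d. So the weighted inequality
  |u|^2 <= (1 + d) |v|^2 + (1 + 1/d) |u - v|^2 compares the norms of the two frame sums with each other
  and gives  c |x|^2 <= norm (sum |v_n|^2) <= C |x|^2  with scalars c, C > 0. Since the frame sum at a x
  is a S a* for S the frame sum at x, these norm bounds hold after conjugation by every a, and taking
  a = (S + e)^(-1/2) turns them into operator inequalities. Hypotheses 2 and 3 reduce to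
  hypothesis 1 by pulling out the supremum and by Hoelder's inequality.

  Strict positivity is defined through positive forms; that it implies self-adjointness and a positive
  scalar lower bound needs enough positive forms, which come from Hahn-Banach.
*)

theory Submission imports Defs begin

section \<open>Square roots and positivity in C*-algebras\<close>

text \<open>The weighted inequality stands in for the triangle inequality of square-summable module
  sequences, which would need the Cauchy-Schwarz inequality of the module; it only expands one
  square. With \<open>m\<close> the power -2 of the norm of the inverse of \<open>A\<close>, and
  \<open>R\<close> the sum of the squares of |omega_n| d(H_n, K_n), comparison with the frame sum of
  H leaves m - (1 + 1/d) R, which is positive for a large parameter \<open>d\<close> because R < m.
  The upper estimate needs no smallness, only convergence of the sum \<open>R\<close>. Conjugation
  covariance of the frame sums holds because the weights are central and orthogonal projections are
  linear over the algebra. For positive elements the obstacle is that spectra say nothing direct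
  about sums, limits or norms. Two tools replace functional calculus: a square root that commutes
  with everything its square commutes with, and the norm bound 1 for unitaries, which the
  C*-identity gives. Products of commuting positive elements are then squares, hence positive, and
  inequalities become factorisations.\<close>

lemma star_zero [simp]: "star (0::'a::unital_cstar_algebra) = 0"
  using star_add[of "0::'a" 0] by simp

lemma star_minus [simp]: "star (- a) = - star (a::'a::unital_cstar_algebra)"
  using star_add[of a "- a"] by (simp add: eq_neg_iff_add_eq_0 add.commute)

lemma star_diff: "star (a - b) = star a - star (b::'a::unital_cstar_algebra)"
  using star_add[of a "- b"] by simp

lemma star_scaleR [simp]: "star (r *\<^sub>R a) = r *\<^sub>R star (a::'a::unital_cstar_algebra)"
  using star_scaleC[of "complex_of_real r" a] by (simp add: scaleC_of_real)

lemma star_one [simp]: "star (1::'a::unital_cstar_algebra) = 1"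
  using star_mult[of "star 1" "1::'a"] by (simp add: star_star)

lemma norm_star [simp]: "norm (star a) = norm (a::'a::unital_cstar_algebra)"
proof -
  have *: "norm b \<le> norm (star b)" for b :: 'a
  proof (cases "norm b = 0")
    case False
    have "norm b * norm b \<le> norm (star b) * norm b"
      using norm_mult_ineq[of "star b" b] by (simp add: cstar_identity power2_eq_square)
    then show ?thesis using False by (simp add: mult_le_cancel_right)
  qed simp
  show ?thesis using *[of a] *[of "star a"] by (simp add: star_star)
qed

lemma bounded_linear_star: "bounded_linear (star :: 'a::unital_cstar_algebra \<Rightarrow> 'a)"
  by (rule bounded_linear_intro[where K = 1]) (simp_all add: star_add)

lemmas tendsto_star = bounded_linear.tendsto[OF bounded_linear_star]

lemma scaleC_1_left [simp]: "scaleC 1 (a::'a::unital_cstar_algebra) = a"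
  using scaleC_of_real[of 1 a] by simp

lemma scaleC_0_left [simp]: "scaleC 0 (a::'a::unital_cstar_algebra) = 0"
  using scaleC_of_real[of 0 a] by simp

lemma scaleC_minus_left: "scaleC (- c) (a::'a::unital_cstar_algebra) = - scaleC c a"
  using scaleC_add_left[of c "- c" a] by (simp add: eq_neg_iff_add_eq_0 add.commute)

lemma scaleC_minus_right: "scaleC c (- a) = - scaleC c (a::'a::unital_cstar_algebra)"
  using scaleC_scaleC[of c "- 1" a] by (simp add: scaleC_minus_left)

lemma scaleC_diff_right: "scaleC c (a - b) = scaleC c a - scaleC c (b::'a::unital_cstar_algebra)"
  using scaleC_add_right[of c a "- b"] by (simp add: scaleC_minus_right)

lemma scaleC_scaleR: "scaleC c (r *\<^sub>R (a::'a::unital_cstar_algebra)) = r *\<^sub>R scaleC c a"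
  by (simp flip: scaleC_of_real add: scaleC_scaleC mult.commute)

lemma norm_selfadj_square:
  "star a = a \<Longrightarrow> norm (a * a) = (norm (a::'a::unital_cstar_algebra))\<^sup>2"
  using cstar_identity[of a] by simp

lemma norm_unitary_le_1:
  assumes "star u * u = (1::'a::unital_cstar_algebra)"
  shows "norm u \<le> 1"
  using cstar_identity[of u] assms by (simp add: power_eq_1_iff abs_square_eq_1)

text \<open>
  For self-adjoint \<open>a\<close> the condition \<open>\<parallel>t - a\<parallel> \<le> t\<close> says that the spectrum lies in \<open>[0, 2t]\<close>. Unlike the
  spectral definition of positivity, it makes the closure under sums immediate.
\<close>

definition psd :: "'a::unital_cstar_algebra \<Rightarrow> bool" where
  "psd a \<longleftrightarrow> star a = a \<and> (\<exists>t\<ge>0. norm (t *\<^sub>R 1 - a) \<le> t)"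

lemma psd_selfadj: "psd a \<Longrightarrow> star a = a"
  by (simp add: psd_def)

lemma psd_0 [simp]: "psd 0"
  by (auto simp: psd_def)

lemma psd_scaleR_1: "0 \<le> r \<Longrightarrow> psd (r *\<^sub>R 1)"
  by (auto simp: psd_def intro!: exI[of _ r])

lemma psd_add:
  assumes "psd a" "psd b" shows "psd (a + b)"
proof -
  obtain s t where "s \<ge> 0" "t \<ge> 0" and *: "norm (s *\<^sub>R 1 - a) \<le> s" "norm (t *\<^sub>R 1 - b) \<le> t"
    using assms by (auto simp: psd_def)
  have "norm ((s + t) *\<^sub>R 1 - (a + b)) \<le> s + t"
    using norm_triangle_ineq[of "s *\<^sub>R 1 - a" "t *\<^sub>R 1 - b"] * by (simp add: algebra_simps)
  then show ?thesis
    using assms \<open>s \<ge> 0\<close> \<open>t \<ge> 0\<close> by (auto simp: psd_def star_add intro!: exI[of _ "s + t"])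
qed

lemma psd_scaleR:
  assumes "psd a" "0 \<le> r" shows "psd (r *\<^sub>R a)"
proof -
  obtain s where "s \<ge> 0" and *: "norm (s *\<^sub>R 1 - a) \<le> s"
    using assms by (auto simp: psd_def)
  have "norm ((r * s) *\<^sub>R 1 - r *\<^sub>R a) = r * norm (s *\<^sub>R 1 - a)"
    using assms by (simp flip: scaleR_scaleR scaleR_diff_right)
  also have "\<dots> \<le> r * s" using * assms by (simp add: mult_left_mono)
  finally show ?thesis
    using assms \<open>s \<ge> 0\<close> by (auto simp: psd_def intro!: exI[of _ "r * s"])
qed

lemma psd_sum: "(\<And>i. i \<in> I \<Longrightarrow> psd (f i)) \<Longrightarrow> psd (\<Sum>i\<in>I. f i)"
  by (induction I rule: infinite_finite_induct) (auto intro: psd_add)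

lemma psd_norm_diff:
  assumes "star a = a" "norm a \<le> r" shows "psd (r *\<^sub>R 1 - a)"
  using assms norm_ge_zero[of a]
  by (auto simp: psd_def star_diff intro!: exI[of _ r] simp del: norm_ge_zero)

text \<open>
  The iteration \<open>y \<mapsto> (x + y\<^sup>2) / 2\<close> converges to \<open>1 - (1 - x)\<^bsup>1/2\<^esup>\<close>. It is dominated by its scalar
  version with \<open>x = 1\<close>, since all iterates are polynomials in \<open>x\<close> with nonnegative coefficients.
\<close>

primrec sqrt_iter :: "'a::real_normed_algebra_1 \<Rightarrow> nat \<Rightarrow> 'a" where
  "sqrt_iter x 0 = 0"
| "sqrt_iter x (Suc n) = (1/2) *\<^sub>R (x + sqrt_iter x n * sqrt_iter x n)"

section \<open>Convergence of the square-root iteration\<close>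

lemma sqrt_iter_commute:
  assumes "x * b = b * x" shows "sqrt_iter x n * b = b * sqrt_iter x n"
proof (induction n)
  case (Suc n)
  have "sqrt_iter x n * sqrt_iter x n * b = b * (sqrt_iter x n * sqrt_iter x n)"
    using Suc by (metis mult.assoc)
  then show ?case using assms by (simp add: algebra_simps)
qed simp

text \<open>The scalar map y -> (1 + y^2)/2 is increasing on the nonnegative reals and fixes 1. The
  three parts are proved together because the step for monotonicity needs nonnegativity.\<close>

lemma sqrt_iter_scalar:
  "0 \<le> sqrt_iter (1::real) n \<and> sqrt_iter (1::real) n \<le> 1 \<and> sqrt_iter (1::real) n \<le> sqrt_iter 1 (Suc n)"
proof (induction n)
  case (Suc n)
  then have "sqrt_iter (1::real) (Suc n) \<le> 1" "0 \<le> sqrt_iter (1::real) (Suc n)"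
    using mult_mono[of "sqrt_iter (1::real) n" 1 "sqrt_iter (1::real) n" 1] by auto
  moreover have "sqrt_iter 1 (Suc n) \<le> sqrt_iter (1::real) (Suc (Suc n))"
    using Suc mult_mono[of "sqrt_iter (1::real) n" "sqrt_iter 1 (Suc n)" "sqrt_iter (1::real) n" "sqrt_iter 1 (Suc n)"]
    by (simp del: sqrt_iter.simps add: sqrt_iter.simps(2)[of 1 n] sqrt_iter.simps(2)[of 1 "Suc n"])
  ultimately show ?case by blast
qed simp

lemma sqrt_iter_norm:
  assumes "norm x \<le> 1" shows "norm (sqrt_iter x n) \<le> sqrt_iter 1 n"
proof (induction n)
  case (Suc n)
  have "norm (x + sqrt_iter x n * sqrt_iter x n) \<le> 1 + sqrt_iter 1 n * sqrt_iter 1 n"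
    by (intro norm_triangle_le add_mono assms order_trans[OF norm_mult_ineq] mult_mono Suc)
       (use sqrt_iter_scalar[of n] in auto)
  then show ?case by simp
qed simp

text \<open>The difference of two squares factors because all iterates commute; each factor is then
  bounded by its scalar counterpart.\<close>

lemma sqrt_iter_step:
  assumes "norm x \<le> 1"
  shows "norm (sqrt_iter x (Suc n) - sqrt_iter x n) \<le> sqrt_iter 1 (Suc n) - sqrt_iter 1 n"
proof (induction n)
  case (Suc n)
  let ?y = "sqrt_iter x" and ?r = "sqrt_iter (1::real)"
  have c: "?y m * ?y n = ?y n * ?y m" for m n
    by (intro sqrt_iter_commute sqrt_iter_commute[symmetric]) simp
  have "?y (Suc (Suc n)) - ?y (Suc n) = (1/2) *\<^sub>R (?y (Suc n) * ?y (Suc n) - ?y n * ?y n)"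
    by (simp only: sqrt_iter.simps(2) scaleR_diff_right[symmetric] add_diff_cancel_left)
  also have "\<dots> = (1/2) *\<^sub>R ((?y (Suc n) + ?y n) * (?y (Suc n) - ?y n))"
    by (simp add: c[of "Suc n" n] algebra_simps del: sqrt_iter.simps)
  finally have "norm (?y (Suc (Suc n)) - ?y (Suc n)) =
      (1/2) * norm ((?y (Suc n) + ?y n) * (?y (Suc n) - ?y n))" by simp
  also have "\<dots> \<le> (1/2) * ((?r (Suc n) + ?r n) * (?r (Suc n) - ?r n))"
    by (intro mult_left_mono order_trans[OF norm_mult_ineq] mult_mono Suc norm_triangle_le add_mono
        sqrt_iter_norm assms add_nonneg_nonneg) (use sqrt_iter_scalar in auto)
  also have "\<dots> = ?r (Suc (Suc n)) - ?r (Suc n)"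
    by (simp add: field_simps)
  finally show ?case .
qed (use assms in simp)

lemma sqrt_iter_diff:
  assumes "norm x \<le> 1" "m \<le> n"
  shows "norm (sqrt_iter x n - sqrt_iter x m) \<le> sqrt_iter 1 n - sqrt_iter 1 m"
  using assms(2)
proof (induction n rule: dec_induct)
  case (step n)
  show ?case
    using norm_triangle_ineq[of "sqrt_iter x (Suc n) - sqrt_iter x n" "sqrt_iter x n - sqrt_iter x m"]
      sqrt_iter_step[OF assms(1), of n] step.IH by (simp del: sqrt_iter.simps)
qed simp

text \<open>Domination by a bounded increasing scalar sequence, rather than a contraction estimate,
  covers the boundary case \<open>norm x = 1\<close>.\<close>

lemma sqrt_iter_convergent:
  fixes x :: "'a::{real_normed_algebra_1, banach}"
  assumes "norm x \<le> 1" shows "convergent (sqrt_iter x)"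
proof -
  have "incseq (sqrt_iter (1::real))"
    by (rule incseq_SucI) (use sqrt_iter_scalar in blast)
  then have "convergent (sqrt_iter (1::real))"
    using sqrt_iter_scalar by (intro Bseq_mono_convergent BseqI'[of _ 1]) (auto simp: incseq_def)
  then have C: "Cauchy (sqrt_iter (1::real))" by (rule convergent_Cauchy)
  have "Cauchy (sqrt_iter x)"
  proof (rule metric_CauchyI)
    fix e :: real assume "0 < e"
    then obtain M where M: "\<And>m n. m \<ge> M \<Longrightarrow> n \<ge> M \<Longrightarrow> dist (sqrt_iter (1::real) m) (sqrt_iter 1 n) < e"
      using C by (meson metric_CauchyD)
    have "dist (sqrt_iter x m) (sqrt_iter x n) < e" if "m \<ge> M" "n \<ge> M" for m n
    proof (cases "m \<le> n")
      case True
      then show ?thesis using sqrt_iter_diff[OF assms True] M[OF that]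
        by (simp add: dist_norm norm_minus_commute)
    next
      case False
      then have "n \<le> m" by simp
      then show ?thesis using sqrt_iter_diff[OF assms, of n m] M[OF that]
        by (simp add: dist_norm)
    qed
    then show "\<exists>M. \<forall>m\<ge>M. \<forall>n\<ge>M. dist (sqrt_iter x m) (sqrt_iter x n) < e" by blast
  qed
  then show ?thesis by (simp add: Cauchy_convergent_iff)
qed

lemma sqrt_one_minus:
  fixes x :: "'a::unital_cstar_algebra"
  assumes "star x = x" "norm x \<le> 1"
  obtains y where "star y = y" "norm y \<le> 1" "(1 - y) * (1 - y) = 1 - x"
    "\<And>b. x * b = b * x \<Longrightarrow> y * b = b * y"
proof -
  obtain y where y: "sqrt_iter x \<longlonglongrightarrow> y"
    using sqrt_iter_convergent[OF assms(2)] by (auto simp: convergent_def)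
  have st: "star (sqrt_iter x n) = sqrt_iter x n" for n
    by (induction n) (simp_all add: star_add star_mult assms)
  have "star y = y"
    using LIMSEQ_unique[OF tendsto_star[OF y]] y st by simp
  moreover have "norm y \<le> 1"
    by (rule LIMSEQ_le_const2[OF tendsto_norm[OF y]])
       (use sqrt_iter_norm[OF assms(2)] sqrt_iter_scalar order_trans in blast)
  moreover have "(1 - y) * (1 - y) = 1 - x"
  proof -
    \<comment> \<open>The limit is a fixed point, 2y = x + y^2, which rearranges to (1 - y)^2 = 1 -
      x.\<close>
    have "(\<lambda>n. sqrt_iter x (Suc n)) \<longlonglongrightarrow> (1/2) *\<^sub>R (x + y * y)"
      unfolding sqrt_iter.simps by (intro tendsto_intros y)
    then have "y = (1/2) *\<^sub>R (x + y * y)"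
      using LIMSEQ_unique[OF LIMSEQ_Suc[OF y]] by blast
    then have "2 *\<^sub>R y = 2 *\<^sub>R ((1/2) *\<^sub>R (x + y * y))" by (rule arg_cong)
    then have "2 *\<^sub>R y = x + y * y" by simp
    then show ?thesis by (simp add: algebra_simps scaleR_2)
  qed
  moreover have "y * b = b * y" if "x * b = b * x" for b
  proof -
    have "(\<lambda>n. sqrt_iter x n * b) \<longlonglongrightarrow> y * b" "(\<lambda>n. b * sqrt_iter x n) \<longlonglongrightarrow> b * y"
      by (intro tendsto_intros y)+
    then show ?thesis using sqrt_iter_commute[OF that] LIMSEQ_unique by auto
  qed
  ultimately show thesis using that by blast
qed

text \<open>Scaling by a witness \<open>t\<close> reduces to \<open>1 - x\<close> with
  \<open>norm x \<le> 1\<close>. The last conclusion is what later makes square roots of commuting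
  elements commute.\<close>

lemma psd_sqrt:
  fixes a :: "'a::unital_cstar_algebra"
  assumes "psd a"
  obtains s where "psd s" "s * s = a" "\<And>b. a * b = b * a \<Longrightarrow> s * b = b * s"
proof -
  obtain t0 where t0: "t0 \<ge> 0" "norm (t0 *\<^sub>R 1 - a) \<le> t0" and sa: "star a = a"
    using assms by (auto simp: psd_def)
  \<comment> \<open>A witness stays one when enlarged; adding 1 permits division by \<open>t\<close>
    also when \<open>t0 = 0\<close>.\<close>
  define t where "t = t0 + 1"
  have t: "t > 0" using t0 by (simp add: t_def)
  have "norm (t *\<^sub>R 1 - a) \<le> t"
    using t0 norm_triangle_ineq[of "t0 *\<^sub>R 1 - a" 1] by (simp add: t_def algebra_simps)
  define x where "x = 1 - (1/t) *\<^sub>R a"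
  have "x = (1/t) *\<^sub>R (t *\<^sub>R 1 - a)" using t by (simp add: x_def algebra_simps)
  then have "norm x \<le> 1" using \<open>norm (t *\<^sub>R 1 - a) \<le> t\<close> t by simp
  have "star x = x" by (simp add: x_def star_diff sa)
  from sqrt_one_minus[OF this \<open>norm x \<le> 1\<close>] obtain y where y: "star y = y" "norm y \<le> 1" "(1 - y) * (1 - y) = 1 - x"
    "\<And>b. x * b = b * x \<Longrightarrow> y * b = b * y" by blast
  have "psd (1 - y)" using psd_norm_diff[OF y(1,2)] by simp
  then have "psd (sqrt t *\<^sub>R (1 - y))" using t by (intro psd_scaleR) auto
  moreover have "(sqrt t *\<^sub>R (1 - y)) * (sqrt t *\<^sub>R (1 - y)) = a"
    using t y(3) by (simp add: x_def)
  moreover have "(sqrt t *\<^sub>R (1 - y)) * b = b * (sqrt t *\<^sub>R (1 - y))" if "a * b = b * a" for b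
  proof -
    have "x * b = b * x" using that by (simp add: x_def algebra_simps)
    then show ?thesis using y(4) by (simp add: algebra_simps)
  qed
  ultimately show thesis using that by blast
qed

text \<open>If \<open>a\<^sup>2 + b\<^sup>2 = 1\<close> for commuting self-adjoint \<open>a\<close> and \<open>b\<close>, then \<open>a + \<i>b\<close> is unitary.\<close>

lemma norm_le_1_of_squares:
  fixes a b :: "'a::unital_cstar_algebra"
  assumes "star a = a" "star b = b" "a * b = b * a" "a * a + b * b = 1"
  shows "norm a \<le> 1"
proof -
  define u where "u = a + scaleC \<i> b"
  have su: "star u = a - scaleC \<i> b"
    by (simp add: u_def star_add star_scaleC assms scaleC_minus_left)
  have "star u * u = 1"
    unfolding su unfolding u_def using assms(3,4)
    by (simp add: algebra_simps scaleC_mult_left scaleC_mult_right scaleC_scaleC scaleC_minus_left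
        scaleC_diff_right)
  then have "norm u \<le> 1" by (rule norm_unitary_le_1)
  moreover have "2 *\<^sub>R a = u + star u" unfolding su unfolding u_def by (simp add: scaleR_2)
  then have "2 * norm a = norm (u + star u)" by (metis norm_scaleR abs_numeral)
  then have "2 * norm a \<le> norm u + norm (star u)" by (simp only: norm_triangle_ineq)
  ultimately show ?thesis by simp
qed

text \<open>The element \<open>a\<close> and the square root \<open>1 - y\<close> of 1 - a^2 commute
  and their squares add up to 1, so \<open>1 - y\<close> has norm at most 1, and so has its square.
  This is the germ of the positivity of squares, with witness 1.\<close>

lemma norm_one_minus_square:
  fixes a :: "'a::unital_cstar_algebra"
  assumes "star a = a" "norm a \<le> 1" shows "norm (1 - a * a) \<le> 1"
proof -
  have n: "norm (a * a) \<le> 1" using assms by (simp add: norm_selfadj_square power_le_one)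
  have "star (a * a) = a * a" using assms by (simp add: star_mult)
  from sqrt_one_minus[OF this n] obtain y where y: "star y = y" "norm y \<le> 1"
    "(1 - y) * (1 - y) = 1 - a * a" "\<And>b. a * a * b = b * (a * a) \<Longrightarrow> y * b = b * y" by blast
  have "y * a = a * y" by (rule y(4)) (simp add: mult.assoc)
  then have "(1 - y) * a = a * (1 - y)" by (simp add: algebra_simps)
  moreover have "(1 - y) * (1 - y) + a * a = 1" unfolding y(3) by simp
  moreover have "star (1 - y) = 1 - y" by (simp add: star_diff y(1))
  ultimately have "norm (1 - y) \<le> 1" using assms(1) norm_le_1_of_squares by blast
  then have "norm ((1 - y) * (1 - y)) \<le> 1"
    using norm_mult_ineq[of "1 - y" "1 - y"] mult_le_one[OF _ norm_ge_zero] order_trans by blast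
  then show ?thesis using y(3) by simp
qed

lemma norm_minus_square:
  fixes a :: "'a::unital_cstar_algebra"
  assumes "star a = a" shows "norm ((norm a)\<^sup>2 *\<^sub>R 1 - a * a) \<le> (norm a)\<^sup>2"
proof (cases "a = 0")
  case False
  let ?r = "norm a"
  have "norm (1 - ((1/?r) *\<^sub>R a) * ((1/?r) *\<^sub>R a)) \<le> 1"
    by (rule norm_one_minus_square) (use assms False in auto)
  then have "?r\<^sup>2 * norm (1 - ((1/?r) *\<^sub>R a) * ((1/?r) *\<^sub>R a)) \<le> ?r\<^sup>2 * 1"
    by (rule mult_left_mono) simp
  moreover have "?r\<^sup>2 *\<^sub>R 1 - a * a = ?r\<^sup>2 *\<^sub>R (1 - ((1/?r) *\<^sub>R a) * ((1/?r) *\<^sub>R a))"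
    using False by (simp add: scaleR_diff_right power2_eq_square)
  ultimately show ?thesis by (simp only: norm_scaleR abs_power2 mult_1_right)
qed simp

lemma psd_square: "star a = a \<Longrightarrow> psd (a * a)"
  using norm_minus_square[of a] by (auto simp: psd_def star_mult intro!: exI[of _ "(norm a)\<^sup>2"])

text \<open>Writing \<open>a\<close> as a square shows that \<open>norm a\<close> is always a
  witness. This canonical choice replaces the unspecified \<open>t\<close> of \<open>psd\<close>
  when a limit is taken.\<close>

lemma psd_norm_bound:
  assumes "psd a" shows "norm (norm a *\<^sub>R 1 - a) \<le> norm a"
proof -
  obtain s where "psd s" "s * s = a" using assms by (rule psd_sqrt) blast
  then show ?thesis
    using norm_minus_square[of s] norm_selfadj_square[of s] psd_selfadj[of s] by simp
qed

text \<open>The roots of \<open>a\<close> and of r - a commute and, divided by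
  \<open>sqrt r\<close>, have squares with sum 1; so the root of \<open>a\<close> has norm at most
  \<open>sqrt r\<close>.\<close>

lemma psd_norm_le:
  fixes a :: "'a::unital_cstar_algebra"
  assumes "psd a" "psd (r *\<^sub>R 1 - a)" "r > 0"
  shows "norm a \<le> r"
proof -
  obtain s where s: "psd s" "s * s = a" "\<And>b. a * b = b * a \<Longrightarrow> s * b = b * s"
    using assms(1) by (rule psd_sqrt) blast
  obtain q where q: "psd q" "q * q = r *\<^sub>R 1 - a"
      "\<And>b. (r *\<^sub>R 1 - a) * b = b * (r *\<^sub>R 1 - a) \<Longrightarrow> q * b = b * q"
    using assms(2) by (rule psd_sqrt) blast
  have "s * a = a * s" using s(2) by (metis mult.assoc)
  then have "q * s = s * q" by (intro q(3)) (simp add: algebra_simps)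
  moreover have "s * s + q * q = r *\<^sub>R 1" using s(2) q(2) by simp
  then have "(1/r) *\<^sub>R (s * s + q * q) = 1" using assms(3) by simp
  then have "(1/r) *\<^sub>R (s * s) + (1/r) *\<^sub>R (q * q) = 1" by (simp only: scaleR_add_right)
  ultimately have "norm ((1 / sqrt r) *\<^sub>R s) \<le> 1"
    using assms(3) psd_selfadj[OF s(1)] psd_selfadj[OF q(1)]
    by (intro norm_le_1_of_squares[of _ "(1 / sqrt r) *\<^sub>R q"]) simp_all
  then have "norm s \<le> sqrt r" using assms(3) by (simp add: field_simps)
  then have "(norm s)\<^sup>2 \<le> r" using assms(3) using power_mono[of "norm s" "sqrt r" 2] by simp
  then show ?thesis using s(2) norm_selfadj_square[OF psd_selfadj[OF s(1)]] by simp
qed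

lemma psd_norm_le_nonneg:
  fixes a :: "'a::unital_cstar_algebra"
  assumes "psd a" "psd (r *\<^sub>R 1 - a)" "r \<ge> 0"
  shows "norm a \<le> r"
proof (rule field_le_epsilon)
  fix e :: real assume "0 < e"
  have "psd ((r *\<^sub>R 1 - a) + e *\<^sub>R 1)" using assms \<open>0 < e\<close> by (intro psd_add psd_scaleR_1) auto
  then show "norm a \<le> r + e"
    using assms \<open>0 < e\<close> by (intro psd_norm_le) (auto simp: algebra_simps)
qed

lemma psd_norm_mono:
  fixes a :: "'a::unital_cstar_algebra"
  assumes "psd a" "psd (b - a)" shows "norm a \<le> norm b"
proof (rule psd_norm_le_nonneg)
  have "star b = b" using psd_selfadj[OF psd_add[OF assms]] by simp
  then have "psd (norm b *\<^sub>R 1 - b)" by (intro psd_norm_diff) auto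
  from psd_add[OF this assms(2)] show "psd (norm b *\<^sub>R 1 - a)" by simp
qed (use assms in auto)

lemma psd_antisym: "psd a \<Longrightarrow> psd (- a) \<Longrightarrow> a = 0"
  using psd_norm_mono[of a 0] by simp

lemma psd_scaleR_1_nonneg:
  assumes "psd (r *\<^sub>R (1::'a::unital_cstar_algebra))" shows "r \<ge> 0"
proof (rule ccontr)
  assume "\<not> r \<ge> 0"
  then have "psd (- (r *\<^sub>R (1::'a)))" using psd_scaleR_1[of "- r"] by simp
  then have "r *\<^sub>R (1::'a) = 0" using assms psd_antisym by blast
  then show False using \<open>\<not> r \<ge> 0\<close> by simp
qed

text \<open>Arbitrary witnesses might be unbounded along the sequence; the norms of
  \<open>f n\<close> are witnesses that converge.\<close>

lemma psd_limit:
  fixes a :: "'a::unital_cstar_algebra"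
  assumes "f \<longlonglongrightarrow> a" "\<And>n. psd (f n)" shows "psd a"
proof -
  have "star a = a"
    using LIMSEQ_unique[OF tendsto_star[OF assms(1)], of a] assms by (simp add: psd_selfadj)
  moreover have "norm (norm a *\<^sub>R 1 - a) \<le> norm a"
    by (rule LIMSEQ_le[of "\<lambda>n. norm (norm (f n) *\<^sub>R 1 - f n)" _ "\<lambda>n. norm (f n)"])
       (use assms psd_norm_bound in \<open>auto intro!: tendsto_intros\<close>)
  ultimately show ?thesis by (auto simp: psd_def intro!: exI[of _ "norm a"])
qed

section \<open>Inverses and spectra\<close>

lemma is_inverse_unique: "is_inverse a b \<Longrightarrow> is_inverse a c \<Longrightarrow> b = (c::'a::monoid_mult)"
  unfolding is_inverse_def by (metis mult.assoc mult_1_left mult_1_right)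

lemma alg_inverse_eq: "is_inverse a b \<Longrightarrow> alg_inverse a = (b::'a::monoid_mult)"
  unfolding alg_inverse_def using is_inverse_unique by blast

lemma is_inverse_alg_inverse: "is_inverse a b \<Longrightarrow> is_inverse a (alg_inverse a :: 'a::monoid_mult)"
  by (simp add: alg_inverse_eq)

definition invertible_elem :: "'a::monoid_mult \<Rightarrow> bool" where
  "invertible_elem a \<longleftrightarrow> (\<exists>b. is_inverse a b)"

lemma invertible_elem_mult:
  "invertible_elem a \<Longrightarrow> invertible_elem b \<Longrightarrow> invertible_elem (a * b :: 'a::monoid_mult)"
proof -
  assume "invertible_elem a" "invertible_elem b"
  then obtain c d where *: "a * c = 1" "c * a = 1" "b * d = 1" "d * b = 1"
    by (auto simp: invertible_elem_def is_inverse_def)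
  have "a * b * (d * c) = a * (b * d) * c" "d * c * (a * b) = d * (c * a) * b"
    by (simp_all add: mult.assoc)
  then show ?thesis using * by (auto simp: invertible_elem_def is_inverse_def intro!: exI[of _ "d * c"])
qed

lemma invertible_elem_factor:
  fixes a b :: "'a::monoid_mult"
  assumes "invertible_elem (a * b)" "a * b = b * a" shows "invertible_elem a"
proof -
  obtain c where c: "a * b * c = 1" "c * (a * b) = 1"
    using assms by (auto simp: invertible_elem_def is_inverse_def)
  have "a * (b * c) = 1" using c(1) by (simp only: mult.assoc)
  moreover have "(c * b) * a = 1" using c(2) unfolding assms(2) by (simp only: mult.assoc)
  ultimately have "b * c = c * b" by (metis mult.assoc mult_1_left mult_1_right)
  with \<open>a * (b * c) = 1\<close> have "is_inverse a (b * c)"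
    using \<open>(c * b) * a = 1\<close> by (simp add: is_inverse_def)
  then show ?thesis by (auto simp: invertible_elem_def)
qed

lemma invertible_elem_scaleR:
  fixes a :: "'a::real_algebra_1"
  assumes "invertible_elem a" "r \<noteq> 0" shows "invertible_elem (r *\<^sub>R a)"
proof -
  obtain b where "a * b = 1" "b * a = 1" using assms by (auto simp: invertible_elem_def is_inverse_def)
  then show ?thesis using assms(2)
    by (auto simp: invertible_elem_def is_inverse_def intro!: exI[of _ "(1/r) *\<^sub>R b"])
qed

lemma invertible_one_minus:
  fixes x :: "'a::{real_normed_algebra_1, banach}"
  assumes "norm x < 1" shows "invertible_elem (1 - x)"
proof -
  have s: "summable (\<lambda>n. x ^ n)" by (rule complete_algebra_summable_geometric[OF assms])
  define S where "S = (\<Sum>n. x ^ n)"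
  have "S = 1 + (\<Sum>n. x ^ Suc n)"
    using suminf_split_head[OF s] by (simp add: S_def)
  moreover have "(\<Sum>n. x ^ Suc n) = x * S"
    using suminf_mult[OF s, of x] by (simp add: S_def)
  moreover have "(\<Sum>n. x ^ Suc n) = S * x"
    using suminf_mult2[OF s, of x] by (simp add: S_def power_commutes)
  ultimately have "S = 1 + x * S" "S = 1 + S * x" by simp_all
  then have "(1 - x) * S = 1" "S * (1 - x) = 1"
    by (simp_all only: left_diff_distrib right_diff_distrib mult_1_left mult_1_right diff_eq_eq)
  then show ?thesis by (auto simp: invertible_elem_def is_inverse_def)
qed

text \<open>If \<open>t\<close> is a witness for a - e, then a / (t + e) differs from 1 by at most t
  / (t + e) < 1, and the Neumann series applies.\<close>

lemma psd_invertible: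
  fixes a :: "'a::unital_cstar_algebra"
  assumes "psd (a - e *\<^sub>R 1)" "e > 0" shows "invertible_elem a"
proof -
  obtain t where t: "t \<ge> 0" "norm (t *\<^sub>R 1 - (a - e *\<^sub>R 1)) \<le> t" using assms by (auto simp: psd_def)
  define x where "x = (1/(t+e)) *\<^sub>R ((t + e) *\<^sub>R 1 - a)"
  have "(t + e) *\<^sub>R 1 - a = t *\<^sub>R 1 - (a - e *\<^sub>R 1)" by (simp add: algebra_simps)
  then have "norm ((t + e) *\<^sub>R 1 - a) \<le> t" using t(2) by (simp only:)
  then have "norm x \<le> t / (t + e)"
    using t(1) assms(2) unfolding x_def norm_scaleR by (simp add: divide_right_mono)
  also have "\<dots> < 1" using t assms by simp
  finally have "invertible_elem ((t + e) *\<^sub>R (1 - x))"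
    using t assms by (intro invertible_elem_scaleR invertible_one_minus) auto
  moreover have "(t + e) *\<^sub>R (1 - x) = a" using t(1) assms(2) by (simp add: x_def scaleR_diff_right)
  ultimately show ?thesis by simp
qed

lemma selfadj_inverse:
  fixes a :: "'a::unital_cstar_algebra"
  assumes "star a = a" "is_inverse a b" shows "star b = b"
proof (rule is_inverse_unique[OF _ assms(2)])
  have "star (a * b) = 1" "star (b * a) = 1" using assms by (simp_all add: is_inverse_def)
  then show "is_inverse a (star b)" using assms by (simp add: is_inverse_def star_mult)
qed

lemma inverse_commute:
  fixes a :: "'a::monoid_mult"
  assumes "is_inverse a b" "a * c = c * a" shows "b * c = c * b"
proof -
  have ab: "a * b = 1" "b * a = 1" using assms(1) by (simp_all add: is_inverse_def)
  have "b * (a * c) * b = b * (c * a) * b" by (simp only: assms(2))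
  then have "(b * a) * (c * b) = (b * c) * (a * b)" by (simp only: mult.assoc)
  then show ?thesis by (simp add: ab)
qed

text \<open>The bound is 1/M with \<open>M = norm d\<close>: the element Mc - 1 = c (M - d) is a
  product of commuting positive elements, hence the square of the product of their roots.\<close>

lemma psd_invertible_lower:
  fixes c :: "'a::unital_cstar_algebra"
  assumes "psd c" "is_inverse c d"
  obtains e where "e > 0" "psd (c - e *\<^sub>R 1)"
proof -
  obtain s where s: "psd s" "s * s = c" using assms(1) by (rule psd_sqrt)
  define M where "M = norm d"
  have "d \<noteq> 0" using assms(2) by (auto simp: is_inverse_def)
  then have "M > 0" by (simp add: M_def)
  have sd: "star d = d" using selfadj_inverse[OF psd_selfadj[OF assms(1)] assms(2)] .
  have "psd (M *\<^sub>R 1 - d)" by (rule psd_norm_diff) (simp_all add: sd M_def)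
  then obtain y where y: "psd y" "y * y = M *\<^sub>R 1 - d"
    "\<And>b. (M *\<^sub>R 1 - d) * b = b * (M *\<^sub>R 1 - d) \<Longrightarrow> y * b = b * y" by (rule psd_sqrt) blast
  have "c * s = s * c" using s(2) by (metis mult.assoc)
  then have "d * s = s * d" using assms(2) inverse_commute by blast
  then have ys: "y * s = s * y" by (intro y(3)) (simp add: algebra_simps)
  have "star (s * y) = s * y" using s(1) y(1) ys by (simp add: star_mult psd_selfadj)
  then have "psd ((s * y) * (s * y))" by (rule psd_square)
  moreover have "(s * y) * (s * y) = M *\<^sub>R c - 1"
  proof -
    have "(s * y) * (s * y) = s * s * (y * y)" using ys by (metis mult.assoc)
    also have "\<dots> = c * (M *\<^sub>R 1 - d)" using s(2) y(2) by simp
    finally show ?thesis using assms(2) by (simp add: right_diff_distrib is_inverse_def)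
  qed
  ultimately have "psd ((1/M) *\<^sub>R (M *\<^sub>R c - 1))" using \<open>M > 0\<close> by (intro psd_scaleR) auto
  then have "psd (c - (1/M) *\<^sub>R 1)" using \<open>M > 0\<close> by (simp add: algebra_simps)
  then show thesis using that[of "1/M"] \<open>M > 0\<close> by simp
qed

text \<open>Suppose \<open>b = t - a\<close> had norm \<open>r > t\<close>. Then r^2 - b^2 = (r -
  b)(r + b) is invertible, the first factor r - t + a by hypothesis and the second because it is at
  least r. So r^2 - b^2 is bounded below by some e > 0, contradicting that b^2 has norm r^2. This
  takes the place of the spectral radius formula.\<close>

lemma psdI:
  fixes a :: "'a::unital_cstar_algebra"
  assumes "star a = a" and inv: "\<And>r. r > 0 \<Longrightarrow> invertible_elem (a + r *\<^sub>R 1)"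
  shows "psd a"
proof (cases "a = 0")
  case False
  define t where "t = norm a"
  define b where "b = t *\<^sub>R 1 - a"
  define r where "r = norm b"
  have sb: "star b = b" using assms by (simp add: b_def star_diff)
  have "r \<le> t"
  proof (rule ccontr)
    assume "\<not> r \<le> t"
    have "invertible_elem ((r - t) *\<^sub>R 1 + a)" using inv[of "r - t"] \<open>\<not> r \<le> t\<close> by (simp add: add.commute)
    moreover have "psd (t *\<^sub>R 1 - a)" using assms by (intro psd_norm_diff) (auto simp: t_def)
    then have "invertible_elem ((r + t) *\<^sub>R 1 - a)"
      using le_less_trans[OF norm_ge_zero[of a], of r] \<open>\<not> r \<le> t\<close>
      by (intro psd_invertible[of _ r]) (simp_all add: algebra_simps t_def)
    ultimately have "invertible_elem (((r - t) *\<^sub>R 1 + a) * ((r + t) *\<^sub>R 1 - a))"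
      by (rule invertible_elem_mult)
    moreover have "((r - t) *\<^sub>R 1 + a) * ((r + t) *\<^sub>R 1 - a) = r\<^sup>2 *\<^sub>R 1 - b * b"
      by (simp add: b_def algebra_simps power2_eq_square)
    ultimately obtain d where "is_inverse (r\<^sup>2 *\<^sub>R 1 - b * b) d" by (auto simp: invertible_elem_def)
    moreover have nb: "norm (b * b) = r\<^sup>2" by (simp add: norm_selfadj_square sb r_def)
    have "psd (r\<^sup>2 *\<^sub>R 1 - b * b)" by (rule psd_norm_diff) (simp_all add: sb star_mult nb)
    ultimately obtain e where e: "e > 0" "psd (r\<^sup>2 *\<^sub>R 1 - b * b - e *\<^sub>R 1)"
      using psd_invertible_lower by blast
    have pb: "psd (b * b)" using sb by (rule psd_square)
    have "psd ((r\<^sup>2 - e) *\<^sub>R (1::'a))" using psd_add[OF e(2) pb] by (simp add: algebra_simps)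
    have "norm (b * b) \<le> r\<^sup>2 - e"
    proof (rule psd_norm_le_nonneg[OF pb])
      show "psd ((r\<^sup>2 - e) *\<^sub>R 1 - b * b)" using e(2) by (simp add: algebra_simps)
      show "0 \<le> r\<^sup>2 - e" by (rule psd_scaleR_1_nonneg) fact
    qed
    then show False using e nb by simp
  qed
  then show ?thesis using assms(1) by (auto simp: psd_def b_def r_def t_def intro!: exI[of _ "norm a"])
qed simp

lemma psd_iff_cstar_positive: "cstar_positive a \<longleftrightarrow> psd (a::'a::unital_cstar_algebra)"
proof
  assume a: "cstar_positive a"
  show "psd a"
  proof (rule psdI)
    fix r :: real assume "r > 0"
    then have "complex_of_real (- r) \<notin> \<real>\<^sub>\<ge>\<^sub>0" by (simp add: complex_nonneg_Reals_iff)
    then have "invertible_elem (scaleC (complex_of_real (- r)) 1 - a)"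
      using a by (auto simp: cstar_positive_def alg_spectrum_def invertible_elem_def)
    then have "invertible_elem ((- 1) *\<^sub>R (scaleC (complex_of_real (- r)) 1 - a))"
      by (rule invertible_elem_scaleR) simp
    then show "invertible_elem (a + r *\<^sub>R 1)"
      by (simp only: scaleC_of_real) (simp add: add.commute)
  qed (use a in \<open>simp add: cstar_positive_def\<close>)
next
  assume a: "psd a"
  have "c \<in> \<real>\<^sub>\<ge>\<^sub>0" if "\<not> invertible_elem (scaleC c 1 - a)" for c
  proof (rule ccontr)
    assume c: "c \<notin> \<real>\<^sub>\<ge>\<^sub>0"
    have "invertible_elem (scaleC c 1 - a)"
    proof (cases "Im c = 0")
      case True
      then have "c = complex_of_real (Re c)" by (simp add: complex_eq_iff)
      then have *: "scaleC c 1 - a = (- 1) *\<^sub>R (a - Re c *\<^sub>R 1)"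
        by (metis scaleC_of_real minus_diff_eq scaleR_minus1_left)
      have "Re c < 0" using c True by (simp add: complex_nonneg_Reals_iff)
      then show ?thesis unfolding *
        using a by (intro invertible_elem_scaleR psd_invertible[of _ "- Re c"]) auto
    next
      case False
      \<comment> \<open>For non-real \<open>c\<close> the product (i Im c - h)(i Im c + h) equals
        -(h^2 + (Im c)^2), which is invertible because h^2 is positive.\<close>
      define h where "h = a - Re c *\<^sub>R 1"
      have "c = complex_of_real (Re c) + \<i> * complex_of_real (Im c)" by (rule complex_eq)
      then have "scaleC c 1 = Re c *\<^sub>R 1 + Im c *\<^sub>R scaleC \<i> 1"
        by (metis scaleC_add_left scaleC_of_real scaleC_scaleC mult.commute)
      then have c1: "scaleC c 1 - a = Im c *\<^sub>R scaleC \<i> 1 - h" by (simp add: h_def add.commute)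
      have "star h = h" using a by (simp add: h_def star_diff psd_selfadj)
      then have "psd (h * h)" by (rule psd_square)
      then have "invertible_elem (h * h + (Im c)\<^sup>2 *\<^sub>R 1)"
        using False by (intro psd_invertible[of _ "(Im c)\<^sup>2"]) auto
      then have i: "invertible_elem ((- 1) *\<^sub>R (h * h + (Im c)\<^sup>2 *\<^sub>R 1))"
        by (rule invertible_elem_scaleR) simp
      define j where "j = scaleC \<i> (1::'a)"
      have j: "j * j = - 1" "h * j = j * h"
        by (simp_all add: j_def scaleC_mult_left scaleC_mult_right scaleC_scaleC scaleC_minus_left)
      have "(scaleC c 1 - a) * (Im c *\<^sub>R j + h) = (- 1) *\<^sub>R (h * h + (Im c)\<^sup>2 *\<^sub>R 1)"
        "(Im c *\<^sub>R j + h) * (scaleC c 1 - a) = (- 1) *\<^sub>R (h * h + (Im c)\<^sup>2 *\<^sub>R 1)"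
        unfolding c1 j_def[symmetric] by (simp_all add: algebra_simps j power2_eq_square)
      then show ?thesis using invertible_elem_factor i by metis
    qed
    then show False using that by simp
  qed
  then show "cstar_positive a"
    using a by (auto simp: cstar_positive_def alg_spectrum_def invertible_elem_def psd_selfadj)
qed

section \<open>Order tests by conjugation, and uniqueness of square roots\<close>

lemma cstar_le_iff: "cstar_le a b \<longleftrightarrow> psd (b - a)"
  by (simp add: cstar_le_def psd_iff_cstar_positive)

text \<open>With \<open>d\<close> the inverse of \<open>s\<close>, the element sps + r equals s (p +
  r d^2) s. Here d^2 is bounded below by a positive scalar, so the middle factor is
  invertible.\<close>

lemma psd_conj:
  fixes p :: "'a::unital_cstar_algebra"
  assumes "psd p" "star s = s" "invertible_elem s" shows "psd (s * p * s)"
proof (rule psdI)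
  show "star (s * p * s) = s * p * s" using assms by (simp add: star_mult psd_selfadj mult.assoc)
  fix r :: real assume "r > 0"
  obtain d where d: "s * d = 1" "d * s = 1" using assms by (auto simp: invertible_elem_def is_inverse_def)
  have "star d = d" using selfadj_inverse[OF assms(2)] d by (simp add: is_inverse_def)
  then have "psd (d * d)" by (rule psd_square)
  moreover have "d * d * (s * s) = d * (d * s) * s" "s * s * (d * d) = s * (s * d) * d"
    by (simp_all only: mult.assoc)
  then have "is_inverse (d * d) (s * s)" using d by (simp add: is_inverse_def)
  ultimately obtain e where e: "e > 0" "psd (d * d - e *\<^sub>R 1)" by (rule psd_invertible_lower) blast
  have "psd (p + r *\<^sub>R (d * d - e *\<^sub>R 1))" using e(2) \<open>r > 0\<close> assms by (intro psd_add psd_scaleR) auto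
  then have "psd (p + r *\<^sub>R (d * d) - (r * e) *\<^sub>R 1)" by (simp add: algebra_simps)
  then have "invertible_elem (p + r *\<^sub>R (d * d))" using e(1) \<open>r > 0\<close>
    by (intro psd_invertible[of _ "r * e"]) auto
  then have "invertible_elem (s * (p + r *\<^sub>R (d * d)) * s)" using assms by (intro invertible_elem_mult)
  moreover have "s * (d * d) * s = (s * d) * (d * s)" by (simp only: mult.assoc)
  then have "s * (d * d) * s = 1" using d by simp
  then have "s * (p + r *\<^sub>R (d * d)) * s = s * p * s + r *\<^sub>R 1"
    by (simp add: distrib_left distrib_right)
  ultimately show "invertible_elem (s * p * s + r *\<^sub>R 1)" by simp
qed

text \<open>
  The operator inequality \<open>p \<le> q\<close> is tested against norms by taking \<open>a = (q + \<epsilon>)\<^bsup>-1/2\<^esup>\<close>, for which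
  \<open>a q a\<close> has norm at most one.
\<close>

lemma psd_diff_of_norm_conj_le:
  fixes p q :: "'a::unital_cstar_algebra"
  assumes p: "psd p" and q: "psd q"
    and le: "\<And>a. norm (a * p * star a) \<le> norm (a * q * star a)"
  shows "psd (q - p)"
proof -
  have "psd (q + e *\<^sub>R 1 - p)" if "e > 0" for e
  proof -
    have "psd (q + e *\<^sub>R 1)" using q \<open>e > 0\<close> by (intro psd_add psd_scaleR_1) auto
    then obtain t where t: "psd t" "t * t = q + e *\<^sub>R 1" by (rule psd_sqrt)
    have "invertible_elem (t * t)" using q \<open>e > 0\<close> t(2) by (intro psd_invertible[of _ e]) auto
    then have ti: "invertible_elem t" by (rule invertible_elem_factor) simp
    then obtain a where a: "t * a = 1" "a * t = 1" by (auto simp: invertible_elem_def is_inverse_def)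
    have st: "star t = t" using t psd_selfadj by blast
    then have sa: "star a = a" using selfadj_inverse a by (auto simp: is_inverse_def)
    have ai: "invertible_elem a" using a by (auto simp: invertible_elem_def is_inverse_def)
    have "a * (t * t) * a = (a * t) * (t * a)" by (simp only: mult.assoc)
    then have "a * (t * t) * a = 1" using a by simp
    then have "a * q * a + e *\<^sub>R (a * a) = 1" unfolding t(2) by (simp add: distrib_left distrib_right)
    then have "1 *\<^sub>R 1 - a * q * a = e *\<^sub>R (a * a)" by (simp add: algebra_simps)
    moreover have "psd (e *\<^sub>R (a * a))" using \<open>e > 0\<close> sa by (intro psd_scaleR psd_square) auto
    ultimately have "norm (a * q * a) \<le> 1"
      using psd_conj[OF q sa ai] by (intro psd_norm_le) auto
    then have "norm (a * p * a) \<le> 1" using le[of a] sa by simp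
    moreover have "star (a * p * a) = a * p * a" using sa p by (simp add: star_mult psd_selfadj mult.assoc)
    ultimately have "psd (1 *\<^sub>R 1 - a * p * a)" by (intro psd_norm_diff)
    \<comment> \<open>Conjugation by \<open>t\<close> undoes that by its inverse \<open>a\<close>
      and turns apa \<le> 1 into p \<le> t^2 = q + e.\<close>
    then have "psd (t * (1 - a * p * a) * t)" using st ti by (intro psd_conj) auto
    moreover have "t * (a * p * a) * t = (t * a) * p * (a * t)" by (simp only: mult.assoc)
    then have "t * (a * p * a) * t = p" using a by simp
    then have "t * (1 - a * p * a) * t = q + e *\<^sub>R 1 - p"
      by (simp add: left_diff_distrib right_diff_distrib t(2))
    ultimately show ?thesis by simp
  qed
  then have "psd (q + (1 / real (Suc n)) *\<^sub>R 1 - p)" for n by simp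
  moreover have "(\<lambda>n. q + (1 / real (Suc n)) *\<^sub>R 1 - p) \<longlonglongrightarrow> q + 0 *\<^sub>R 1 - p"
    by (intro tendsto_intros LIMSEQ_Suc[OF lim_1_over_n])
  ultimately show ?thesis using psd_limit by fastforce
qed

text \<open>For d = b - s with \<open>s\<close> a root commuting with \<open>b\<close>, the positive
  elements dbd and dsd add up to d(b + s)d = (b^2 - s^2)d = 0, so both vanish and d^3 = 0.\<close>

lemma psd_sqrt_unique:
  fixes a b c :: "'a::unital_cstar_algebra"
  assumes "psd b" "psd c" "b * b = a" "c * c = a" shows "b = c"
proof -
  \<comment> \<open>Two arbitrary roots are not known to commute, so each is compared with the root
    that commutes with whatever commutes with \<open>a\<close>.\<close>
  have *: "b = s" if s: "psd s" "s * s = a" "\<And>x. a * x = x * a \<Longrightarrow> s * x = x * s"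
    and b: "psd b" "b * b = a" for b s :: 'a
  proof -
    have "a * b = b * a" using b(2) by (metis mult.assoc)
    then have sb: "s * b = b * s" by (rule s(3))
    define d where "d = b - s"
    have sd: "star d = d" using b(1) s(1) by (simp add: d_def star_diff psd_selfadj)
    \<comment> \<open>As \<open>d\<close> need not be invertible, \<open>psd_conj\<close> does not
      apply; instead dxd is the square of \<open>t * d\<close>.\<close>
    have pd: "psd (d * x * d)" if "psd x" "x * d = d * x" for x
    proof -
      obtain t where t: "psd t" "t * t = x" "\<And>y. x * y = y * x \<Longrightarrow> t * y = y * t"
        using \<open>psd x\<close> by (rule psd_sqrt) blast
      have td: "t * d = d * t" using that(2) by (rule t(3))
      then have "star (t * d) = t * d" using t(1) sd by (simp add: star_mult psd_selfadj)
      then have "psd ((t * d) * (t * d))" by (rule psd_square)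
      moreover have "(t * d) * (t * d) = d * x * d" using td t(2) by (metis mult.assoc)
      ultimately show ?thesis by simp
    qed
    have p1: "psd (d * b * d)" using b(1) sb by (intro pd) (simp_all add: d_def algebra_simps)
    have p2: "psd (d * s * d)" using s(1) sb by (intro pd) (simp_all add: d_def algebra_simps)
    have "d * (b + s) = 0" using sb b(2) s(2) by (simp add: d_def algebra_simps)
    then have "d * (b + s) * d = 0" by simp
    then have sum: "d * b * d + d * s * d = 0" by (simp only: distrib_left distrib_right)
    then have "d * s * d = - (d * b * d)" by (simp add: eq_neg_iff_add_eq_0 add.commute)
    then have "d * b * d = 0" using psd_antisym p1 p2 by metis
    then have "d * s * d = 0" using sum by simp
    with \<open>d * b * d = 0\<close> have "d * d * d = 0" by (simp add: d_def left_diff_distrib right_diff_distrib)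
    then have "(d * d) * (d * d) = 0" by (metis mult.assoc mult_zero_left)
    then have "norm (d * d) = 0" using norm_selfadj_square[of "d * d"] sd by (simp add: star_mult)
    then have "d = 0" using norm_selfadj_square[OF sd] by simp
    then show "b = s" by (simp add: d_def)
  qed
  have "psd a" using assms psd_square psd_selfadj by blast
  then obtain s where "psd s" "s * s = a" "\<And>x. a * x = x * a \<Longrightarrow> s * x = x * s"
    by (rule psd_sqrt) blast
  then show ?thesis using *[of s b] *[of s c] assms by metis
qed

lemma cstar_sqrt_square:
  assumes "psd (a::'a::unital_cstar_algebra)"
  shows "psd (cstar_sqrt a)" "(cstar_sqrt a)\<^sup>2 = a"
proof -
  obtain s where "psd s" "s * s = a" using assms by (rule psd_sqrt)
  then have "\<exists>!b. cstar_positive b \<and> b\<^sup>2 = a"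
    using psd_sqrt_unique unfolding psd_iff_cstar_positive power2_eq_square by blast
  from theI'[OF this] show "psd (cstar_sqrt a)" "(cstar_sqrt a)\<^sup>2 = a"
    unfolding cstar_sqrt_def psd_iff_cstar_positive by simp_all
qed

section \<open>Positive forms\<close>

text \<open>Scaling is asked only as an inequality for positive factors, which passes to infima;
  equality follows by also applying it to the reciprocal factor.\<close>

definition sublinear :: "('v::real_vector \<Rightarrow> real) \<Rightarrow> bool" where
  "sublinear p \<longleftrightarrow> (\<forall>x y. p (x + y) \<le> p x + p y) \<and> (\<forall>r>0. \<forall>x. p (r *\<^sub>R x) \<le> r * p x)"

lemma sublinear_add: "sublinear p \<Longrightarrow> p (x + y) \<le> p x + p y"
  by (simp add: sublinear_def)

lemma sublinear_0: "sublinear p \<Longrightarrow> p 0 = 0"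
proof -
  assume "sublinear p"
  then have "p ((1/2) *\<^sub>R 0) \<le> (1/2) * p 0" "p (2 *\<^sub>R 0) \<le> 2 * p 0"
    unfolding sublinear_def by (metis half_gt_zero zero_less_one, metis zero_less_numeral)
  then show ?thesis by simp
qed

lemma sublinear_scaleR:
  assumes "sublinear p" "r \<ge> 0" shows "p (r *\<^sub>R x) = r * p x"
proof (cases "r = 0")
  case False
  then have "r > 0" using assms by simp
  have *: "p (r *\<^sub>R x) \<le> r * p x" if "r > 0" for r x using assms(1) that by (simp add: sublinear_def)
  have "p ((1/r) *\<^sub>R (r *\<^sub>R x)) \<le> (1/r) * p (r *\<^sub>R x)" using \<open>r > 0\<close> by (intro *) simp
  then have "r * p x \<le> p (r *\<^sub>R x)" using \<open>r > 0\<close> by (simp add: field_simps)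
  then show ?thesis using *[OF \<open>r > 0\<close>, of x] by simp
qed (use assms sublinear_0 in simp)

lemma sublinear_minus: "sublinear p \<Longrightarrow> - p (- x) \<le> p x"
  using sublinear_add[of p x "- x"] sublinear_0[of p] by simp

text \<open>Letting the index \<open>k\<close> depend on the arguments serves two uses: a family of
  translates with parameter in [0, \<infinity>), and a chain of functionals, where \<open>k\<close>
  is one of the given members.\<close>

lemma sublinear_INF:
  assumes ne: "I \<noteq> {}"
    and add: "\<And>i j x y. i \<in> I \<Longrightarrow> j \<in> I \<Longrightarrow> \<exists>k\<in>I. F k (x + y) \<le> F i x + F j y"
    and scale: "\<And>i r x. i \<in> I \<Longrightarrow> r > 0 \<Longrightarrow> \<exists>k\<in>I. F k (r *\<^sub>R x) \<le> r * F i x"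
    and bdd: "\<And>x. bdd_below ((\<lambda>i. F i x) ` I)"
  shows "sublinear (\<lambda>x. INF i\<in>I. F i x :: real)"
proof -
  have le: "(INF i\<in>I. F i x) \<le> F k x" if "k \<in> I" for k x
    using bdd that by (rule cINF_lower)
  have "(INF i\<in>I. F i (x + y)) \<le> (INF i\<in>I. F i x) + (INF i\<in>I. F i y)" for x y
  proof -
    have "(INF i\<in>I. F i (x + y)) - F j y \<le> (INF i\<in>I. F i x)" if "j \<in> I" for j
      using add[OF _ that] le by (intro cINF_greatest[OF ne]) (meson diff_le_eq order_trans)
    then have "(INF i\<in>I. F i (x + y)) - (INF i\<in>I. F i x) \<le> F j y" if "j \<in> I" for j
      using that by (simp add: algebra_simps)
    then have "(INF i\<in>I. F i (x + y)) - (INF i\<in>I. F i x) \<le> (INF i\<in>I. F i y)"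
      by (intro cINF_greatest[OF ne])
    then show ?thesis by simp
  qed
  moreover have "(INF i\<in>I. F i (r *\<^sub>R x)) \<le> r * (INF i\<in>I. F i x)" if "r > 0" for r x
  proof -
    have "(INF i\<in>I. F i (r *\<^sub>R x)) \<le> r * F i x" if "i \<in> I" for i
      using scale[OF that \<open>r > 0\<close>] le by (meson order_trans)
    then have "(INF i\<in>I. F i (r *\<^sub>R x)) / r \<le> F i x" if "i \<in> I" for i
      using that \<open>r > 0\<close> by (simp add: field_simps)
    then have "(INF i\<in>I. F i (r *\<^sub>R x)) / r \<le> (INF i\<in>I. F i x)"
      by (intro cINF_greatest[OF ne])
    then show ?thesis using \<open>r > 0\<close> by (simp add: field_simps)
  qed
  ultimately show ?thesis by (simp add: sublinear_def)
qed

text \<open>Here \<open>q x\<close> is the infimum over t \<ge> 0 of p (x + ta) - t p(a); the values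
  t = 0 and t = 1 give the two upper bounds.\<close>

lemma sublinear_shift:
  fixes p :: "'v::real_vector \<Rightarrow> real"
  assumes p: "sublinear p"
  obtains q where "sublinear q" "q \<le> p" "\<And>x. q x \<le> p (x + a) - p a"
proof -
  define F where "F t x = p (x + t *\<^sub>R a) - t * p a" for t x
  have bdd: "bdd_below ((\<lambda>t. F t x) ` {0..})" for x
  proof (rule bdd_belowI2)
    fix t :: real assume "t \<in> {0..}"
    then have "t * p a = p (t *\<^sub>R a)" using sublinear_scaleR[OF p] by simp
    also have "\<dots> \<le> p (x + t *\<^sub>R a) + p (- x)" using sublinear_add[OF p, of "x + t *\<^sub>R a" "- x"] by simp
    finally show "- p (- x) \<le> F t x" by (simp add: F_def)
  qed
  have "sublinear (\<lambda>x. INF t\<in>{0..}. F t x)"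
  proof (rule sublinear_INF[OF _ _ _ bdd])
    fix i j :: real and x y :: 'v assume "i \<in> {0..}" "j \<in> {0..}"
    then show "\<exists>k\<in>{0..}. F k (x + y) \<le> F i x + F j y"
      using sublinear_add[OF p, of "x + i *\<^sub>R a" "y + j *\<^sub>R a"]
      by (intro bexI[of _ "i + j"]) (auto simp: F_def algebra_simps)
  next
    fix i r :: real and x :: 'v assume "i \<in> {0..}" "r > 0"
    then show "\<exists>k\<in>{0..}. F k (r *\<^sub>R x) \<le> r * F i x"
      using sublinear_scaleR[OF p, of r "x + i *\<^sub>R a"]
      by (intro bexI[of _ "r * i"]) (auto simp: F_def algebra_simps)
  qed auto
  moreover have "(INF t\<in>{0..}. F t x) \<le> p x" for x
    using cINF_lower[OF bdd, of 0 x] by (simp add: F_def)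
  moreover have "(INF t\<in>{0..}. F t x) \<le> p (x + a) - p a" for x
    using cINF_lower[OF bdd, of 1 x] by (simp add: F_def)
  ultimately show thesis by (intro that[of "\<lambda>x. INF t\<in>{0..}. F t x"]) (auto simp: le_fun_def)
qed

lemma sublinear_minimal:
  assumes p: "sublinear p"
  obtains g where "sublinear g" "g \<le> p" "\<And>q. sublinear q \<Longrightarrow> q \<le> g \<Longrightarrow> q = g"
proof -
  define A where "A = {q. sublinear q \<and> q \<le> p}"
  \<comment> \<open>The order is reversed, so that the maximal element given by Zorn's lemma is
    pointwise minimal.\<close>
  define P where "P = (\<lambda>q r :: 'a \<Rightarrow> real. r \<le> q)"
  have "\<exists>m\<in>A. \<forall>a\<in>A. P m a \<longrightarrow> a = m"
  proof (rule predicate_Zorn)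
    show "partial_order_on A (relation_of P A)"
      by (rule partial_order_on_relation_ofI) (auto simp: P_def)
    fix C assume C: "C \<in> Chains (relation_of P A)"
    show "\<exists>u\<in>A. \<forall>a\<in>C. P a u"
    proof (cases "C = {}")
      case True
      then show ?thesis using p by (auto simp: A_def)
    next
      case False
      have CA: "C \<subseteq> A" using C by (auto simp: Chains_def relation_of_def)
      have tot: "q \<le> r \<or> r \<le> q" if "q \<in> C" "r \<in> C" for q r
        using C that by (auto simp: Chains_def relation_of_def P_def)
      have bdd: "bdd_below ((\<lambda>q. q x) ` C)" for x
      proof (rule bdd_belowI2)
        fix q assume "q \<in> C"
        then have "sublinear q" "q (- x) \<le> p (- x)" using CA by (auto simp: A_def le_fun_def)
        then show "- p (- x) \<le> q x" using sublinear_minus[of q x] by linarith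
      qed
      have "sublinear (\<lambda>x. INF q\<in>C. q x)"
      proof (rule sublinear_INF[OF False _ _ bdd])
        fix q r x y assume qr: "q \<in> C" "r \<in> C"
        then have "sublinear q" "sublinear r" using CA by (auto simp: A_def)
        then have "q (x + y) \<le> q x + q y" "r (x + y) \<le> r x + r y" by (simp_all add: sublinear_add)
        moreover have "q y \<le> r y \<or> r x \<le> q x" using tot[OF qr] by (auto simp: le_fun_def)
        ultimately have "q (x + y) \<le> q x + r y \<or> r (x + y) \<le> q x + r y" by linarith
        then show "\<exists>k\<in>C. k (x + y) \<le> q x + r y" using qr by blast
      next
        fix q r x assume "q \<in> C" "r > (0::real)"
        then show "\<exists>k\<in>C. k (r *\<^sub>R x) \<le> r * q x" using CA by (auto simp: A_def sublinear_def)
      qed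
      moreover have "(INF q\<in>C. q x) \<le> q x" if "q \<in> C" for q x
        using bdd that by (rule cINF_lower)
      moreover have "\<exists>q\<in>C. q \<le> p" using CA False by (auto simp: A_def)
      ultimately show ?thesis
        by (intro bexI[of _ "\<lambda>x. INF q\<in>C. q x"]) (auto simp: A_def P_def le_fun_def intro: order_trans)
    qed
  qed
  then show thesis using that by (auto simp: A_def P_def)
qed

text \<open>Hahn--Banach: minimal sublinear functionals are linear.\<close>

lemma sublinear_attained_by_linear:
  assumes p: "sublinear p"
  obtains g where "linear g" "g \<le> p" "g h = p h"
proof -
  \<comment> \<open>The shift in direction \<open>h\<close> forces q(-h) \<le> p(0) - p(h) = -p(h);
    a linear functional below \<open>q\<close> therefore takes at \<open>h\<close> at least the
    value \<open>p h\<close>.\<close>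
  obtain q where q: "sublinear q" "q \<le> p" "\<And>x. q x \<le> p (x + h) - p h"
    using p by (rule sublinear_shift[of p h]) blast
  obtain g where g: "sublinear g" "g \<le> q" "\<And>q. sublinear q \<Longrightarrow> q \<le> g \<Longrightarrow> q = g"
    using q(1) by (rule sublinear_minimal) blast
  have add: "g (x + a) = g x + g a" for x a
  proof -
    \<comment> \<open>By minimality this shift is \<open>g\<close> itself, which gives the reverse
      of subadditivity.\<close>
    obtain r where "sublinear r" "r \<le> g" "r x \<le> g (x + a) - g a"
      using g(1) by (rule sublinear_shift[of g a]) blast
    then have "g x \<le> g (x + a) - g a" using g(3) by metis
    then show ?thesis using sublinear_add[OF g(1), of x a] by simp
  qed
  have neg: "g (- x) = - g x" for x using add[of x "- x"] sublinear_0[OF g(1)] by simp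
  have "linear g"
  proof (rule linearI[OF add])
    fix r :: real and x
    show "g (r *\<^sub>R x) = r *\<^sub>R g x"
    proof (cases "r \<ge> 0")
      case False
      then have "g ((- r) *\<^sub>R x) = (- r) * g x" by (intro sublinear_scaleR g) simp
      then show ?thesis using neg[of "r *\<^sub>R x"] by simp
    qed (simp add: sublinear_scaleR[OF g(1)])
  qed
  moreover have "g \<le> p" using g(2) q(2) by simp
  moreover have "g (- h) \<le> p (- h + h) - p h"
    using le_funD[OF g(2), of "- h"] q(3)[of "- h"] by simp
  then have "p h \<le> g h" using neg[of h] sublinear_0[OF p] by simp
  then have "g h = p h" using le_funD[OF \<open>g \<le> p\<close>, of h] by simp
  ultimately show thesis using that by blast
qed

section \<open>Real and imaginary parts, and the supply of positive forms\<close>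

definition re_part :: "'a::unital_cstar_algebra \<Rightarrow> 'a" where
  "re_part a = (1/2) *\<^sub>R (a + star a)"

text \<open>This is (a - star a) / (2i); in this form it inherits the rules for
  \<open>re_part\<close>.\<close>

definition im_part :: "'a::unital_cstar_algebra \<Rightarrow> 'a" where
  "im_part a = re_part (scaleC (- \<i>) a)"

lemma star_re_part: "star (re_part a) = re_part a"
  by (simp add: re_part_def star_add star_star add.commute)

lemma star_im_part: "star (im_part a) = im_part a"
  by (simp add: im_part_def star_re_part)

lemma re_part_selfadj: "star a = a \<Longrightarrow> re_part a = a"
  by (simp add: re_part_def flip: scaleR_2)

lemma im_part_selfadj: "star a = a \<Longrightarrow> im_part a = 0"
  by (simp add: im_part_def re_part_def star_scaleC flip: scaleC_add_left)

lemma re_part_im_part: "a = re_part a + scaleC \<i> (im_part a)"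
proof -
  have "scaleC \<i> (im_part a) = (1/2) *\<^sub>R (a - star a)"
    by (simp add: im_part_def re_part_def star_scaleC scaleC_scaleR scaleC_add_right
        scaleC_diff_right scaleC_scaleC scaleC_minus_left)
  then show ?thesis by (simp add: re_part_def flip: scaleR_add_right scaleR_2)
qed

lemma selfadj_iff_im_part: "star a = a \<longleftrightarrow> im_part a = 0"
  using im_part_selfadj re_part_im_part[of a] star_re_part[of a]
  by (metis add_0_right scaleC_scaleR scaleR_zero_left)

lemma re_part_add: "re_part (a + b) = re_part a + re_part b"
  by (simp add: re_part_def star_add algebra_simps)

lemma re_part_diff: "re_part (a - b) = re_part a - re_part b"
  by (simp add: re_part_def star_diff algebra_simps)

lemma im_part_add: "im_part (a + b) = im_part a + im_part b"
  by (simp add: im_part_def scaleC_add_right re_part_add)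

lemma re_part_scaleR: "re_part (r *\<^sub>R a) = r *\<^sub>R re_part a"
  by (simp add: re_part_def algebra_simps)

lemma re_part_scaleC: "re_part (scaleC c a) = Re c *\<^sub>R re_part a - Im c *\<^sub>R im_part a"
proof -
  have "scaleC c a = scaleC (complex_of_real (Re c)) a + scaleC (complex_of_real (- Im c)) (scaleC (- \<i>) a)"
    unfolding scaleC_scaleC scaleC_add_left[symmetric] by (rule arg_cong[of _ _ "\<lambda>c. scaleC c a"]) (simp add: complex_eq_iff)
  then show ?thesis
    unfolding scaleC_of_real by (simp add: im_part_def re_part_diff re_part_scaleR)
qed

lemma im_part_scaleC: "im_part (scaleC c a) = Re c *\<^sub>R im_part a + Im c *\<^sub>R re_part a"
  unfolding im_part_def[of "scaleC c a"] scaleC_scaleC re_part_scaleC by simp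

lemma norm_re_part_le: "norm (re_part a) \<le> norm a"
  using norm_triangle_ineq[of a "star a"] by (simp add: re_part_def)

text \<open>The sublinear functional below sends a self-adjoint element to the maximum of its spectrum.\<close>

lemma positive_form_exists:
  fixes h :: "'a::unital_cstar_algebra"
  assumes h: "star h = h" and t0: "\<And>t. psd (t *\<^sub>R 1 - h) \<Longrightarrow> t0 \<le> t"
  obtains g :: "'a \<Rightarrow> real" where "linear g" "g 1 \<ge> 1" "g h \<ge> t0"
    "positive_form (\<lambda>b. Complex (g (re_part b)) (g (im_part b)))"
proof -
  define S where "S b = {t. psd (t *\<^sub>R 1 - re_part b)}" for b :: 'a
  define p where "p b = Inf (S b)" for b
  have S_norm: "norm b \<in> S b" for b
    by (auto simp: S_def intro!: psd_norm_diff star_re_part norm_re_part_le)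
  have S_lower: "- norm b \<le> t" if "t \<in> S b" for b t
  proof -
    have "psd (norm b *\<^sub>R 1 - (- re_part b))"
      by (intro psd_norm_diff) (simp_all add: star_re_part norm_re_part_le)
    with that have "psd ((t *\<^sub>R 1 - re_part b) + (norm b *\<^sub>R 1 - (- re_part b)))"
      by (intro psd_add) (simp_all add: S_def)
    then have "psd ((t + norm b) *\<^sub>R (1::'a))" by (simp add: algebra_simps)
    then show ?thesis using psd_scaleR_1_nonneg by fastforce
  qed
  have p_le: "p b \<le> t" if "t \<in> S b" for b t
    unfolding p_def using that S_lower by (intro cInf_lower bdd_belowI[of _ "- norm b"]) auto
  have p_ge: "r \<le> p b" if "\<And>t. t \<in> S b \<Longrightarrow> r \<le> t" for b r
    unfolding p_def using S_norm that by (intro cInf_greatest) auto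
  have "sublinear p"
    unfolding sublinear_def
  proof (intro conjI allI impI)
    fix x y
    have sum: "p (x + y) \<le> s + t" if "s \<in> S x" "t \<in> S y" for s t
    proof (rule p_le)
      have "psd ((s *\<^sub>R 1 - re_part x) + (t *\<^sub>R 1 - re_part y))"
        using that by (intro psd_add) (simp_all add: S_def)
      then show "s + t \<in> S (x + y)" by (simp add: S_def re_part_add algebra_simps)
    qed
    have "p (x + y) - s \<le> p y" if "s \<in> S x" for s
      by (rule p_ge) (use sum[OF that] in fastforce)
    then have "p (x + y) - p y \<le> p x" by (intro p_ge) fastforce
    then show "p (x + y) \<le> p x + p y" by simp
  next
    fix r x assume "r > (0::real)"
    have "p (r *\<^sub>R x) \<le> r * t" if "t \<in> S x" for t
    proof (rule p_le)
      have "psd (r *\<^sub>R (t *\<^sub>R 1 - re_part x))"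
        using that \<open>r > 0\<close> by (intro psd_scaleR) (simp_all add: S_def)
      then show "r * t \<in> S (r *\<^sub>R x)" by (simp add: S_def re_part_scaleR algebra_simps)
    qed
    then have "p (r *\<^sub>R x) / r \<le> p x" using \<open>r > 0\<close> by (intro p_ge) (simp add: field_simps)
    then show "p (r *\<^sub>R x) \<le> r * p x" using \<open>r > 0\<close> by (simp add: field_simps)
  qed
  then obtain g where g: "linear g" "g \<le> p" "g h = p h" by (rule sublinear_attained_by_linear)
  have g0: "g b \<le> t" if "t \<in> S b" for b t
    using p_le[OF that] g(2) by (meson le_fun_def order_trans)
  \<comment> \<open>Domination by \<open>p\<close> is an upper bound; applied to negatives it yields
    the lower bounds for \<open>g\<close> at 1 and, further down, at positive elements.\<close>
  have "g (- 1) \<le> - 1" by (rule g0) (simp add: S_def re_part_selfadj)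
  then have "1 \<le> g 1" using g(1) by (simp add: linear_neg)
  moreover have "t0 \<le> g h"
    unfolding g(3) using h by (intro p_ge t0) (simp add: S_def re_part_selfadj)
  \<comment> \<open>The form is the complex-linear extension of the restriction of \<open>g\<close>
    to self-adjoint elements.\<close>
  moreover have "positive_form (\<lambda>b. Complex (g (re_part b)) (g (im_part b)))"
    unfolding positive_form_def
  proof (intro conjI allI impI)
    fix b :: 'a assume "cstar_positive b"
    then have "psd b" by (simp add: psd_iff_cstar_positive)
    then have sb: "star b = b" by (rule psd_selfadj)
    have "g (- b) \<le> 0"
      by (rule g0) (simp add: S_def re_part_selfadj sb \<open>psd b\<close>)
    then have "g b \<ge> 0" using g(1) by (simp add: linear_neg)
    then show "Complex (g (re_part b)) (g (im_part b)) \<in> \<real>\<^sub>\<ge>\<^sub>0"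
      using g(1) by (simp add: re_part_selfadj im_part_selfadj sb linear_0 complex_nonneg_Reals_iff)
  qed (use g(1) in \<open>simp_all add: complex_eq_iff re_part_add im_part_add re_part_scaleC
      im_part_scaleC linear_add linear_diff linear_cmul\<close>)
  ultimately show thesis using that g(1) by blast
qed

lemma strictly_positive_form:
  assumes "strictly_positive a" "linear g" "g 1 \<ge> (1::real)"
    "positive_form (\<lambda>b. Complex (g (re_part b)) (g (im_part b)))"
  shows "g (im_part a) = 0" "g (re_part a) > 0"
proof -
  have "Complex (g (re_part 1)) (g (im_part 1)) \<noteq> 0" using assms(3) by (simp add: re_part_selfadj complex_eq_iff)
  then have "Complex (g (re_part a)) (g (im_part a)) \<in> \<real> \<and> Re (Complex (g (re_part a)) (g (im_part a))) > 0"
    using assms(1,4) unfolding strictly_positive_def by blast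
  then show "g (im_part a) = 0" "g (re_part a) > 0" by (simp_all add: complex_is_Real_iff)
qed

lemma psd_diff_scaleR_1_limit:
  fixes k :: "'a::unital_cstar_algebra"
  assumes "\<And>e. e > 0 \<Longrightarrow> psd (e *\<^sub>R 1 - k)" shows "psd (- k)"
proof (rule psd_limit)
  show "(\<lambda>n. (1 / real (Suc n)) *\<^sub>R 1 - k) \<longlonglongrightarrow> - k"
    using tendsto_diff[OF tendsto_scaleR[OF LIMSEQ_Suc[OF lim_1_over_n] tendsto_const] tendsto_const, of 1 k]
    by simp
  show "psd ((1 / real (Suc n)) *\<^sub>R 1 - k)" for n by (rule assms) simp
qed

text \<open>If the imaginary part is nonzero, then it or its negative is not below 0, so some
  \<open>g\<close> is nonzero there; the resulting form has a non-real value at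
  \<open>a\<close>.\<close>

lemma strictly_positive_selfadj:
  fixes a :: "'a::unital_cstar_algebra"
  assumes "strictly_positive a" shows "star a = a"
proof (rule ccontr)
  assume "star a \<noteq> a"
  then have "im_part a \<noteq> 0" by (simp add: selfadj_iff_im_part)
  then have "\<not> psd (- im_part a) \<or> \<not> psd (- (- im_part a))" using psd_antisym by fastforce
  then obtain k where k: "k = im_part a \<or> k = - im_part a" "\<not> psd (- k)" by blast
  have sk: "star k = k" using k(1) star_im_part[of a] by auto
  obtain e where e: "e > 0" "\<not> psd (e *\<^sub>R 1 - k)" using psd_diff_scaleR_1_limit k(2) by blast
  have "e \<le> t" if "psd (t *\<^sub>R 1 - k)" for t
  proof (rule ccontr)
    assume "\<not> e \<le> t"
    then have "psd ((t *\<^sub>R 1 - k) + (e - t) *\<^sub>R 1)" using that by (intro psd_add psd_scaleR_1) auto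
    then show False using e(2) by (simp add: algebra_simps)
  qed
  then obtain g where g: "linear g" "g 1 \<ge> 1" "g k \<ge> e"
    "positive_form (\<lambda>b. Complex (g (re_part b)) (g (im_part b)))"
    using positive_form_exists[OF sk] by blast
  have "g (im_part a) = 0" using strictly_positive_form[OF assms g(1,2,4)] by simp
  then have "g k = 0" using k(1) g(1) by (auto simp: linear_neg)
  then show False using e g by simp
qed

text \<open>If no positive scalar lies below \<open>a\<close>, the maximum of the spectrum of -a is
  at least 0. A single form attains it and is not positive at \<open>a\<close>; attainment is what
  makes the strict positivity uniform.\<close>

lemma strictly_positive_lower:
  fixes a :: "'a::unital_cstar_algebra"
  assumes "strictly_positive a" obtains e where "e > 0" "psd (a - e *\<^sub>R 1)"
proof (rule ccontr)
  assume "\<not> thesis"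
  then have no: "\<not> psd (a - e *\<^sub>R 1)" if "e > 0" for e using that \<open>\<And>e. \<lbrakk>e > 0; psd (a - e *\<^sub>R 1)\<rbrakk> \<Longrightarrow> thesis\<close> by blast
  have sa: "star a = a" using assms by (rule strictly_positive_selfadj)
  have "0 \<le> t" if "psd (t *\<^sub>R 1 - (- a))" for t
    using no[of "- t"] that by (fastforce simp: add.commute)
  then obtain g where g: "linear g" "g 1 \<ge> 1" "g (- a) \<ge> 0"
    "positive_form (\<lambda>b. Complex (g (re_part b)) (g (im_part b)))"
    using positive_form_exists[of "- a" 0] sa by auto
  have "g a > 0" using strictly_positive_form[OF assms g(1,2,4)] sa by (simp add: re_part_selfadj)
  then show False using g by (simp add: linear_neg)
qed

lemma strictly_positive_is_inverse:
  fixes a :: "'a::unital_cstar_algebra"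
  assumes "strictly_positive a" shows "is_inverse a (alg_inverse a)"
proof -
  obtain e where "e > 0" "psd (a - e *\<^sub>R 1)" using assms by (rule strictly_positive_lower)
  then have "invertible_elem a" using psd_invertible by blast
  then show ?thesis using is_inverse_alg_inverse by (auto simp: invertible_elem_def)
qed

text \<open>A positive form with value 0 at 1 vanishes at every self-adjoint \<open>x\<close>, since
  \<open>x\<close> and \<open>- x\<close> lie below \<open>norm x\<close>, and hence
  everywhere.\<close>

lemma strictly_positive_scaleR_1:
  assumes "r > 0" shows "strictly_positive (r *\<^sub>R (1::'a::unital_cstar_algebra))"
  unfolding strictly_positive_def
proof (intro allI impI, elim conjE exE)
  fix f :: "'a \<Rightarrow> complex" and b assume f: "positive_form f" and b: "f b \<noteq> 0"
  have add: "f (x + y) = f x + f y" and sc: "f (scaleC c x) = c * f x"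
    and pos: "psd x \<Longrightarrow> f x \<in> \<real>\<^sub>\<ge>\<^sub>0" for x y c
    using f by (auto simp: positive_form_def psd_iff_cstar_positive)
  have scR: "f (s *\<^sub>R x) = of_real s * f x" for s x using sc[of "of_real s" x] by (simp add: scaleC_of_real)
  have neg: "f (- x) = - f x" for x using scR[of "- 1" x] by simp
  have f1: "f 1 \<in> \<real>\<^sub>\<ge>\<^sub>0" using psd_scaleR_1[of 1] by (intro pos) simp
  have "f 1 \<noteq> 0"
  proof
    assume 0: "f 1 = 0"
    have z: "f x = 0" if x: "star x = x" for x
    proof -
      have "f (norm x *\<^sub>R 1 + - x) \<in> \<real>\<^sub>\<ge>\<^sub>0" using psd_norm_diff[of x "norm x"] x by (intro pos) simp
      moreover have "f (norm x *\<^sub>R 1 + x) \<in> \<real>\<^sub>\<ge>\<^sub>0" using psd_norm_diff[of "- x" "norm x"] x by (intro pos) simp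
      ultimately show ?thesis unfolding add scR neg 0 by (simp add: complex_nonneg_Reals_iff complex_eq_iff)
    qed
    have "f b = f (re_part b) + \<i> * f (im_part b)" using re_part_im_part[of b] add sc by metis
    then show False using b z[OF star_re_part] z[OF star_im_part] by simp
  qed
  then show "f (r *\<^sub>R 1) \<in> \<real> \<and> Re (f (r *\<^sub>R 1)) > 0"
    using f1 assms by (auto simp: scR complex_nonneg_Reals_iff complex_is_Real_iff complex_eq_iff zero_less_mult_iff)
qed

section \<open>Hilbert modules and frames\<close>

text \<open>The comparison is made in the order of the algebra, on blocks of terms: frame series
  converge in norm, but perhaps not absolutely.\<close>

lemma summable_psd_comparison:
  fixes f g :: "nat \<Rightarrow> 'a::unital_cstar_algebra"
  assumes "summable f" "\<And>n. psd (g n)" "\<And>n. psd (f n - g n)"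
  shows "summable g"
  unfolding summable_Cauchy
proof (intro allI impI)
  fix e :: real assume "e > 0"
  then obtain N where N: "\<And>m n. m \<ge> N \<Longrightarrow> norm (sum f {m..<n}) < e"
    using assms(1) unfolding summable_Cauchy by blast
  have "norm (sum g {m..<n}) \<le> norm (sum f {m..<n})" for m n
    using assms(2,3) by (intro psd_norm_mono psd_sum) (auto simp flip: sum_subtractf intro: psd_sum)
  then show "\<exists>N. \<forall>m\<ge>N. \<forall>n. norm (sum g {m..<n}) < e" using N le_less_trans by blast
qed

lemma psd_suminf:
  fixes f :: "nat \<Rightarrow> 'a::unital_cstar_algebra"
  assumes "summable f" "\<And>n. psd (f n)" shows "psd (\<Sum>n. f n)"
  by (rule psd_limit[OF summable_LIMSEQ[OF assms(1)]]) (rule psd_sum[OF assms(2)])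

context hilbert_module
begin

section \<open>Calculus of the inner product\<close>

lemma ip_add_right: "ip x (y + z) = ip x y + ip x z"
  unfolding ip_star[of x "y + z"] ip_star[of x y] ip_star[of x z] by (simp only: ip_add_left star_add)

lemma ip_smult_right: "ip x (act a y) = ip x y * star a"
  unfolding ip_star[of x "act a y"] ip_star[of x y] by (simp only: ip_smult_left star_mult)

lemma ip_scaleR_left: "ip (r *\<^sub>R x) y = r *\<^sub>R ip x y"
  by (simp add: scaleR_eq ip_smult_left)

lemma ip_scaleR_right: "ip x (r *\<^sub>R y) = r *\<^sub>R ip x y"
  by (simp add: scaleR_eq ip_smult_right)

lemma ip_minus_left: "ip (- x) y = - ip x y"
  using ip_scaleR_left[of "- 1" x y] by simp

lemma ip_minus_right: "ip x (- y) = - ip x y"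
  using ip_scaleR_right[of x "- 1" y] by simp

lemma ip_diff_left: "ip (x - y) z = ip x z - ip y z"
  using ip_add_left[of x "- y" z] by (simp add: ip_minus_left)

lemma ip_diff_right: "ip x (y - z) = ip x y - ip x z"
  using ip_add_right[of x y "- z"] by (simp add: ip_minus_right)

lemma psd_ip: "psd (ip x x)"
  using ip_positive by (simp add: psd_iff_cstar_positive)

lemma module_abs_square: "(module_abs ip x)\<^sup>2 = ip x x"
  unfolding module_abs_def by (rule cstar_sqrt_square) (rule psd_ip)

lemma norm_ip_self: "norm (ip x x) = (norm x)\<^sup>2"
proof -
  have "star (module_abs ip x) = module_abs ip x"
    unfolding module_abs_def by (intro psd_selfadj cstar_sqrt_square psd_ip)
  then have "norm (module_abs ip x * module_abs ip x) = (norm x)\<^sup>2"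
    by (simp add: norm_selfadj_square norm_eq)
  then show ?thesis using module_abs_square[of x] by (simp add: power2_eq_square)
qed

lemma smult_zero_right: "act a 0 = 0"
  using smult_add_right[of a 0 0] by simp

lemma smult_minus_right: "act a (- x) = - act a x"
  using smult_add_right[of a x "- x"] smult_zero_right[of a] by (simp add: eq_neg_iff_add_eq_0 add.commute)

lemma smult_diff_right: "act a (x - y) = act a x - act a y"
  using smult_add_right[of a x "- y"] by (simp add: smult_minus_right)

lemma norm_smult_le: "norm (act a x) \<le> norm a * norm x"
proof (rule power2_le_imp_le)
  have "(norm (act a x))\<^sup>2 = norm (a * ip x x * star a)"
    by (simp add: ip_smult_left ip_smult_right mult.assoc flip: norm_ip_self)
  also have "\<dots> \<le> norm (a * ip x x) * norm (star a)" by (rule norm_mult_ineq)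
  also have "\<dots> \<le> (norm a * norm (ip x x)) * norm a"
    by (auto intro!: mult_right_mono norm_mult_ineq)
  also have "\<dots> = (norm a * norm x)\<^sup>2" by (simp add: norm_ip_self power2_eq_square)
  finally show "(norm (act a x))\<^sup>2 \<le> (norm a * norm x)\<^sup>2" .
qed simp

text \<open>This is \<open>0 \<le> |d\<^bsup>1/2\<^esup> u - d\<^bsup>-1/2\<^esup> w|\<^sup>2\<close>.\<close>

lemma psd_ip_add_weighted:
  assumes "d > 0"
  shows "psd ((1 + d) *\<^sub>R ip u u + (1 + 1/d) *\<^sub>R ip w w - ip (u + w) (u + w))"
proof -
  define r where "r = sqrt d"
  have r: "r > 0" "d = r * r" using assms by (simp_all add: r_def)
  have "ip (r *\<^sub>R u - (1/r) *\<^sub>R w) (r *\<^sub>R u - (1/r) *\<^sub>R w) =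
      (1 + d) *\<^sub>R ip u u + (1 + 1/d) *\<^sub>R ip w w - ip (u + w) (u + w)"
    using r(1) unfolding r(2)
    by (simp add: ip_diff_left ip_diff_right ip_add_left ip_add_right ip_scaleR_left ip_scaleR_right
        scaleR_add_left scaleR_diff_right)
  then show ?thesis using psd_ip by metis
qed

section \<open>Orthogonal projections and the gap\<close>

lemma orth_proj_decomp:
  assumes "K \<in> Comp act ip"
  shows "orth_proj ip K x \<in> K" "x - orth_proj ip K x \<in> orth_compl ip K"
    and orth_proj_unique: "\<And>y. y \<in> K \<Longrightarrow> x - y \<in> orth_compl ip K \<Longrightarrow> orth_proj ip K x = y"
proof -
  have sub: "closed_submodule act K" and int: "K \<inter> orth_compl ip K = {0}"
    using assms by (auto simp: Comp_def)
  obtain y z where yz: "y \<in> K" "z \<in> orth_compl ip K" "x = y + z"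
    using assms unfolding Comp_def by blast
  have uniq: "y = y'" if "y \<in> K" "y' \<in> K" "x - y \<in> orth_compl ip K" "x - y' \<in> orth_compl ip K" for y y'
  proof -
    \<comment> \<open>Negatives in a submodule come from the action of -1.\<close>
    have "act (- 1) y' \<in> K" using sub that by (simp add: closed_submodule_def)
    moreover have "act (- 1) y' = - y'" using scaleR_eq[of "- 1" y'] by simp
    ultimately have "y + - y' \<in> K" using sub that unfolding closed_submodule_def by metis
    moreover have "y - y' = (x - y') - (x - y)" by simp
    then have "y - y' \<in> orth_compl ip K" using that(3,4) by (simp only:) (simp add: orth_compl_def ip_diff_left)
    ultimately have "y - y' \<in> K \<inter> orth_compl ip K" by simp
    then show ?thesis using int by simp
  qed
  have *: "y \<in> K \<and> x - y \<in> orth_compl ip K" using yz by simp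
  have "\<exists>!y. y \<in> K \<and> x - y \<in> orth_compl ip K" using * uniq by blast
  from theI'[OF this] show "orth_proj ip K x \<in> K" "x - orth_proj ip K x \<in> orth_compl ip K"
    unfolding orth_proj_def by simp_all
  then show "\<And>y. y \<in> K \<Longrightarrow> x - y \<in> orth_compl ip K \<Longrightarrow> orth_proj ip K x = y"
    using uniq by blast
qed

lemma orth_proj_add:
  assumes "K \<in> Comp act ip" shows "orth_proj ip K (x + y) = orth_proj ip K x + orth_proj ip K y"
proof (rule orth_proj_unique[OF assms])
  show "orth_proj ip K x + orth_proj ip K y \<in> K"
    using assms orth_proj_decomp[OF assms] by (auto simp: Comp_def closed_submodule_def)
  show "x + y - (orth_proj ip K x + orth_proj ip K y) \<in> orth_compl ip K"
    using orth_proj_decomp(2)[OF assms, of x] orth_proj_decomp(2)[OF assms, of y]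
    by (simp add: orth_compl_def ip_diff_left ip_add_left)
qed

lemma orth_proj_smult:
  assumes "K \<in> Comp act ip" shows "orth_proj ip K (act a x) = act a (orth_proj ip K x)"
proof (rule orth_proj_unique[OF assms])
  show "act a (orth_proj ip K x) \<in> K"
    using assms orth_proj_decomp[OF assms] by (auto simp: Comp_def closed_submodule_def)
  show "act a x - act a (orth_proj ip K x) \<in> orth_compl ip K"
    using orth_proj_decomp(2)[OF assms, of x]
    by (simp add: orth_compl_def ip_smult_left flip: smult_diff_right)
qed

lemma orth_proj_diff:
  assumes "K \<in> Comp act ip" shows "orth_proj ip K (x - y) = orth_proj ip K x - orth_proj ip K y"
  using orth_proj_add[OF assms, of "x - y" y] by simp

lemma ip_orth_decomp:
  assumes "u \<in> K" "v \<in> orth_compl ip K"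
  shows "ip (u + v) (u + v) = ip u u + ip v v" "ip (u - v) (u - v) = ip u u + ip v v"
proof -
  have "ip v u = 0" using assms by (simp add: orth_compl_def)
  then have "ip u v = 0" using ip_star[of u v] by simp
  then show "ip (u + v) (u + v) = ip u u + ip v v" "ip (u - v) (u - v) = ip u u + ip v v"
    using \<open>ip v u = 0\<close> by (simp_all add: ip_add_left ip_add_right ip_diff_left ip_diff_right)
qed

lemma ip_orth_proj:
  assumes "K \<in> Comp act ip"
  shows "ip x x = ip (orth_proj ip K x) (orth_proj ip K x) + ip (x - orth_proj ip K x) (x - orth_proj ip K x)"
  using ip_orth_decomp(1)[OF orth_proj_decomp(1,2)[OF assms, of x]] by simp

text \<open>Write (P - Q)x as P(1 - Q)x - (1 - P)Qx. The two parts are orthogonal and dominated by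
  (1 - Q)x and Qx, whose squares add up to that of x. This makes the supremum in
  \<open>onorm\<close> finite and keeps the gap in the domain of arcsin.\<close>

lemma norm_orth_proj_diff_le:
  assumes U: "U \<in> Comp act ip" and V: "V \<in> Comp act ip"
  shows "norm (orth_proj ip U x - orth_proj ip V x) \<le> norm x"
proof -
  let ?P = "orth_proj ip U" and ?Q = "orth_proj ip V"
  have eq: "?P x - ?Q x = ?P (x - ?Q x) - (?Q x - ?P (?Q x))" by (simp add: orth_proj_diff[OF U])
  have 1: "ip (?P x - ?Q x) (?P x - ?Q x) =
      ip (?P (x - ?Q x)) (?P (x - ?Q x)) + ip (?Q x - ?P (?Q x)) (?Q x - ?P (?Q x))"
    unfolding eq by (rule ip_orth_decomp(2)[OF orth_proj_decomp(1)[OF U] orth_proj_decomp(2)[OF U]])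
  have "ip x x - ip (?P x - ?Q x) (?P x - ?Q x) =
      ip (x - ?Q x - ?P (x - ?Q x)) (x - ?Q x - ?P (x - ?Q x)) + ip (?P (?Q x)) (?P (?Q x))"
    unfolding 1 using ip_orth_proj[OF V, of x] ip_orth_proj[OF U, of "x - ?Q x"] ip_orth_proj[OF U, of "?Q x"]
    by (simp add: algebra_simps)
  then have "psd (ip x x - ip (?P x - ?Q x) (?P x - ?Q x))" by (simp add: psd_add psd_ip)
  then have "norm (ip (?P x - ?Q x) (?P x - ?Q x)) \<le> norm (ip x x)"
    by (intro psd_norm_mono psd_ip)
  then show ?thesis by (simp add: norm_ip_self)
qed

lemma norm_orth_proj_diff_le_gap:
  assumes U: "U \<in> Comp act ip" and V: "V \<in> Comp act ip"
  shows "norm (orth_proj ip U x - orth_proj ip V x) \<le> gap ip U V * norm x"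
    "0 \<le> gap ip U V" "gap ip U V \<le> 1"
proof -
  have scale: "orth_proj ip W (r *\<^sub>R x) = r *\<^sub>R orth_proj ip W x" if "W \<in> Comp act ip" for W r x
    unfolding scaleR_eq by (rule orth_proj_smult[OF that])
  have bl: "bounded_linear (\<lambda>x. orth_proj ip U x - orth_proj ip V x)"
    by (rule bounded_linear_intro[where K = 1])
       (simp_all add: orth_proj_add scale U V norm_orth_proj_diff_le scaleR_diff_right)
  show "norm (orth_proj ip U x - orth_proj ip V x) \<le> gap ip U V * norm x"
    unfolding gap_def by (rule onorm[OF bl])
  show "0 \<le> gap ip U V" unfolding gap_def by (rule onorm_pos_le[OF bl])
  show "gap ip U V \<le> 1" unfolding gap_def
    by (rule onorm_bound) (simp_all add: norm_orth_proj_diff_le U V)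
qed

lemma gap_le_angle:
  assumes "U \<in> Comp act ip" "V \<in> Comp act ip"
  shows "gap ip U V \<le> angle ip U V"
proof -
  note g = norm_orth_proj_diff_le_gap(2,3)[OF assms]
  then have "gap ip U V = sin (angle ip U V)" by (simp add: angle_def)
  also have "\<dots> \<le> angle ip U V" using g by (intro sin_x_le_x) (simp add: angle_def arcsin_nonneg)
  finally show ?thesis .
qed

section \<open>Series of squares and frame sums\<close>

lemma summable_ip_add:
  assumes "summable (\<lambda>n. ip (u n) (u n))" "summable (\<lambda>n. ip (w n) (w n))"
  shows "summable (\<lambda>n. ip (u n + w n) (u n + w n))"
proof (rule summable_psd_comparison[OF _ psd_ip psd_ip_add_weighted])
  show "summable (\<lambda>n. (1 + 1) *\<^sub>R ip (u n) (u n) + (1 + 1 / 1) *\<^sub>R ip (w n) (w n))"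
    by (intro summable_add summable_scaleR_right assms)
qed simp

lemma norm_suminf_ip_add_le:
  assumes u: "summable (\<lambda>n. ip (u n) (u n))" and w: "summable (\<lambda>n. ip (w n) (w n))" and "d > 0"
  shows "norm (\<Sum>n. ip (u n + w n) (u n + w n)) \<le>
    (1 + d) * norm (\<Sum>n. ip (u n) (u n)) + (1 + 1/d) * norm (\<Sum>n. ip (w n) (w n))"
proof -
  let ?U = "\<Sum>n. ip (u n) (u n)" and ?W = "\<Sum>n. ip (w n) (w n)"
  let ?f = "\<lambda>n. (1 + d) *\<^sub>R ip (u n) (u n) + (1 + 1/d) *\<^sub>R ip (w n) (w n)"
  note s = summable_ip_add[OF u w]
  have f: "?f sums ((1 + d) *\<^sub>R ?U + (1 + 1/d) *\<^sub>R ?W)"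
    by (intro sums_add sums_scaleR_right summable_sums u w)
  have "(\<lambda>n. ?f n - ip (u n + w n) (u n + w n)) sums
      ((1 + d) *\<^sub>R ?U + (1 + 1/d) *\<^sub>R ?W - (\<Sum>n. ip (u n + w n) (u n + w n)))"
    by (intro sums_diff f summable_sums s)
  then have "psd ((1 + d) *\<^sub>R ?U + (1 + 1/d) *\<^sub>R ?W - (\<Sum>n. ip (u n + w n) (u n + w n)))"
    using psd_suminf psd_ip_add_weighted[OF \<open>d > 0\<close>] by (metis (no_types, lifting) sums_iff)
  moreover have "psd (\<Sum>n. ip (u n + w n) (u n + w n))" using s psd_ip by (rule psd_suminf)
  ultimately have "norm (\<Sum>n. ip (u n + w n) (u n + w n)) \<le> norm ((1 + d) *\<^sub>R ?U + (1 + 1/d) *\<^sub>R ?W)"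
    by (intro psd_norm_mono)
  also have "\<dots> \<le> norm ((1 + d) *\<^sub>R ?U) + norm ((1 + 1/d) *\<^sub>R ?W)" by (rule norm_triangle_ineq)
  also have "\<dots> = (1 + d) * norm ?U + (1 + 1/d) * norm ?W" using \<open>d > 0\<close> by simp
  finally show ?thesis .
qed

text \<open>A self-adjoint central weight can be split, one factor going to each side of the inner
  product. Each frame term thus becomes an algebra-valued square, as the perturbation estimate
  needs.\<close>

lemma frame_term_eq:
  assumes "weight \<omega>"
  shows "frame_term ip U \<omega> x n = ip (act (\<omega> n) (orth_proj ip (U n) x)) (act (\<omega> n) (orth_proj ip (U n) x))"
proof -
  have "star (\<omega> n) = \<omega> n" using assms strictly_positive_selfadj by (auto simp: weight_def)
  moreover have "ip y y * \<omega> n = \<omega> n * ip y y" for y using assms by (auto simp: weight_def central_def)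
  ultimately show ?thesis
    unfolding frame_term_def module_abs_square ip_smult_left ip_smult_right
    by (simp add: power2_eq_square mult.assoc)
qed

lemma frame_term_smult:
  assumes "weight \<omega>" "U n \<in> Comp act ip"
  shows "frame_term ip U \<omega> (act a x) n = a * frame_term ip U \<omega> x n * star a"
proof -
  have "\<omega> n * b = b * \<omega> n" for b using assms(1) by (auto simp: weight_def central_def)
  then have "act (\<omega> n) (act a y) = act a (act (\<omega> n) y)" for y by (simp add: smult_smult)
  then show ?thesis
    unfolding frame_term_eq[OF assms(1)] orth_proj_smult[OF assms(2)]
    by (simp add: ip_smult_left ip_smult_right mult.assoc)
qed

lemma psd_frame_term: "weight \<omega> \<Longrightarrow> psd (frame_term ip U \<omega> x n)"
  by (simp add: frame_term_eq psd_ip)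

lemma suminf_frame_term_smult:
  assumes "weight \<omega>" "\<And>n. U n \<in> Comp act ip" "summable (frame_term ip U \<omega> x)"
  shows "(\<Sum>n. frame_term ip U \<omega> (act a x) n) = a * (\<Sum>n. frame_term ip U \<omega> x n) * star a"
proof -
  have "(\<Sum>n. a * frame_term ip U \<omega> x n * star a) = (\<Sum>n. a * frame_term ip U \<omega> x n) * star a"
    by (rule suminf_mult2[OF summable_mult[OF assms(3)], symmetric])
  then show ?thesis by (simp only: frame_term_smult[OF assms(1,2)] suminf_mult[OF assms(3)])
qed

lemma star_fusion_frame_of_norm_bounds:
  assumes w: "weight \<omega>" and U: "\<And>n. U n \<in> Comp act ip"
    and s: "\<And>x. summable (frame_term ip U \<omega> x)" and "c > 0"
    and lower: "\<And>x. c * (norm x)\<^sup>2 \<le> norm (\<Sum>n. frame_term ip U \<omega> x n)"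
    and upper: "\<And>x. norm (\<Sum>n. frame_term ip U \<omega> x n) \<le> C * (norm x)\<^sup>2"
  shows "star_fusion_frame act ip U \<omega>"
proof -
  \<comment> \<open>\<open>C\<close> is not assumed positive, whereas an upper bound has to be
    strictly positive.\<close>
  define D where "D = max C 1"
  have "D > 0" by (simp add: D_def)
  have abs_scaleR: "(module_abs ip (act (sqrt r *\<^sub>R 1) x))\<^sup>2 = r *\<^sub>R ip x x" if "r > 0" for r x
    using that by (simp add: module_abs_square ip_scaleR_left ip_scaleR_right flip: scaleR_eq)
  have conj: "a * ip x x * star a = ip (act a x) (act a x)" for a x
    by (simp add: ip_smult_left ip_smult_right mult.assoc)
  have ps: "psd (\<Sum>n. frame_term ip U \<omega> x n)" for x
    by (rule psd_suminf[OF s psd_frame_term[OF w]])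
  have "psd ((\<Sum>n. frame_term ip U \<omega> x n) - c *\<^sub>R ip x x)" for x
  proof (rule psd_diff_of_norm_conj_le[OF _ ps])
    fix a
    show "norm (a * c *\<^sub>R ip x x * star a) \<le> norm (a * (\<Sum>n. frame_term ip U \<omega> x n) * star a)"
      using lower[of "act a x"] \<open>c > 0\<close>
      by (simp add: suminf_frame_term_smult[OF w U s, symmetric] conj norm_ip_self)
  qed (use \<open>c > 0\<close> in \<open>simp add: psd_scaleR psd_ip\<close>)
  moreover have "psd (D *\<^sub>R ip x x - (\<Sum>n. frame_term ip U \<omega> x n))" for x
  proof (rule psd_diff_of_norm_conj_le[OF ps])
    fix a
    have "C * (norm (act a x))\<^sup>2 \<le> D * (norm (act a x))\<^sup>2" by (simp add: D_def mult_right_mono)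
    then show "norm (a * (\<Sum>n. frame_term ip U \<omega> x n) * star a) \<le> norm (a * D *\<^sub>R ip x x * star a)"
      using upper[of "act a x"] \<open>D > 0\<close>
      by (simp add: suminf_frame_term_smult[OF w U s, symmetric] conj norm_ip_self)
  qed (use \<open>D > 0\<close> in \<open>simp add: psd_scaleR psd_ip\<close>)
  ultimately have "fusion_bounds act ip U \<omega> (sqrt c *\<^sub>R 1) (sqrt D *\<^sub>R 1)"
    using \<open>c > 0\<close> \<open>D > 0\<close>
    by (simp add: fusion_bounds_def strictly_positive_scaleR_1 cstar_le_iff abs_scaleR)
  then show ?thesis using w U s by (auto simp: star_fusion_frame_def)
qed

lemma norm_frame_sum_bounds:
  assumes "fusion_bounds act ip U \<omega> A B" "weight \<omega>" "summable (frame_term ip U \<omega> x)"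
  shows "norm (alg_inverse A) powi (- 2) * (norm x)\<^sup>2 \<le> norm (\<Sum>n. frame_term ip U \<omega> x n)"
    "norm (\<Sum>n. frame_term ip U \<omega> x n) \<le> (norm B)\<^sup>2 * (norm x)\<^sup>2"
    "norm (alg_inverse A) > 0"
proof -
  let ?S = "\<Sum>n. frame_term ip U \<omega> x n" and ?N = "norm (alg_inverse A)"
  have b: "strictly_positive A" "psd (?S - ip (act A x) (act A x))" "psd (ip (act B x) (act B x) - ?S)"
    using assms(1) by (auto simp: fusion_bounds_def cstar_le_iff module_abs_square)
  have inv: "is_inverse A (alg_inverse A)" using b(1) by (rule strictly_positive_is_inverse)
  then show N: "?N > 0" by (auto simp: is_inverse_def)
  have "psd ?S" by (rule psd_suminf[OF assms(3) psd_frame_term[OF assms(2)]])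
  then have "norm ?S \<le> (norm (act B x))\<^sup>2" using psd_norm_mono b(3) by (metis norm_ip_self)
  also have "\<dots> \<le> (norm B * norm x)\<^sup>2" by (intro power_mono norm_smult_le) simp
  finally show "norm ?S \<le> (norm B)\<^sup>2 * (norm x)\<^sup>2" by (simp add: power_mult_distrib)
  have "x = act (alg_inverse A) (act A x)" using inv by (simp add: smult_smult is_inverse_def smult_one)
  then have "norm x \<le> ?N * norm (act A x)" using norm_smult_le by metis
  then have "norm x / ?N \<le> norm (act A x)" using N by (simp add: field_simps)
  then have "(norm x / ?N)\<^sup>2 \<le> (norm (act A x))\<^sup>2" using N by (intro power_mono) auto
  also have "\<dots> \<le> norm ?S" using psd_norm_mono[OF psd_ip b(2)] by (simp add: norm_ip_self)
  finally show "?N powi (- 2) * (norm x)\<^sup>2 \<le> norm ?S"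
    by (simp add: power_divide power_int_minus divide_inverse power_mult_distrib power_inverse mult.commute)
qed

lemma star_fusion_frame_perturbation:
  assumes w: "weight \<omega>" and H: "\<And>n. H n \<in> Comp act ip" and K: "\<And>n. K n \<in> Comp act ip"
    and frame: "star_fusion_frame act ip H \<omega>" and A: "lower_bound act ip H \<omega> A"
    and R: "series_less (\<lambda>n. (norm (\<omega> n))\<^sup>2 * (gap ip (H n) (K n))\<^sup>2) (norm (alg_inverse A) powi (- 2))"
  shows "star_fusion_frame act ip K \<omega>"
proof -
  obtain B where B: "fusion_bounds act ip H \<omega> A B" using A by (auto simp: lower_bound_def)
  define m where "m = norm (alg_inverse A) powi (- 2)"
  define r where "r = (\<lambda>n. (norm (\<omega> n))\<^sup>2 * (gap ip (H n) (K n))\<^sup>2)"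
  have sr: "summable r" and Rm: "suminf r < m"
    using R by (auto simp: series_less_def r_def m_def)
  define R where "R = suminf r"
  have "R \<ge> 0" unfolding R_def by (rule suminf_nonneg[OF sr]) (simp add: r_def)
  define T where "T U x n = act (\<omega> n) (orth_proj ip (U n) x)" for U x n
  have ft: "frame_term ip U \<omega> x = (\<lambda>n. ip (T U x n) (T U x n))" for U x
    by (rule ext) (simp add: frame_term_eq[OF w] T_def)
  have sH: "summable (\<lambda>n. ip (T H x n) (T H x n))" for x
    using frame ft unfolding star_fusion_frame_def by metis
  define D where "D x n = T K x n - T H x n" for x n
  have nD: "norm (ip (D x n) (D x n)) \<le> r n * (norm x)\<^sup>2" for x n
  proof -
    have "D x n = act (\<omega> n) (orth_proj ip (K n) x - orth_proj ip (H n) x)"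
      by (simp add: D_def T_def smult_diff_right)
    then have "norm (D x n) \<le> norm (\<omega> n) * norm (orth_proj ip (H n) x - orth_proj ip (K n) x)"
      using norm_smult_le by (metis norm_minus_commute)
    also have "\<dots> \<le> norm (\<omega> n) * (gap ip (H n) (K n) * norm x)"
      by (intro mult_left_mono norm_orth_proj_diff_le_gap H K) simp
    finally have "(norm (D x n))\<^sup>2 \<le> (norm (\<omega> n) * (gap ip (H n) (K n) * norm x))\<^sup>2"
      by (intro power_mono) auto
    then show ?thesis by (simp add: norm_ip_self r_def power_mult_distrib mult.assoc)
  qed
  have sr': "summable (\<lambda>n. r n * (norm x)\<^sup>2)" for x using sr by (rule summable_mult2)
  have sD: "summable (\<lambda>n. ip (D x n) (D x n))" for x
    by (rule summable_comparison_test'[OF sr' nD])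
  have ND: "norm (\<Sum>n. ip (D x n) (D x n)) \<le> R * (norm x)\<^sup>2" for x
  proof -
    have sn: "summable (\<lambda>n. norm (ip (D x n) (D x n)))"
      by (rule summable_comparison_test'[OF sr']) (use nD in simp)
    have "norm (\<Sum>n. ip (D x n) (D x n)) \<le> (\<Sum>n. norm (ip (D x n) (D x n)))"
      by (rule summable_norm[OF sn])
    also have "\<dots> \<le> (\<Sum>n. r n * (norm x)\<^sup>2)" by (rule suminf_le[OF nD sn sr'])
    also have "\<dots> = R * (norm x)\<^sup>2" using suminf_mult2[OF sr] by (simp add: R_def)
    finally show ?thesis .
  qed
  \<comment> \<open>The sequence of \<open>H\<close> is that of \<open>K\<close> plus
    \<open>- D\<close>, so the same inequality serves in both directions.\<close>
  have mD: "summable (\<lambda>n. ip (- D x n) (- D x n))"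
      "(\<Sum>n. ip (- D x n) (- D x n)) = (\<Sum>n. ip (D x n) (D x n))" for x
    using sD by (simp_all add: ip_minus_left ip_minus_right)
  have TK: "T K x n = T H x n + D x n" and TH: "T H x n = T K x n + - D x n" for x n
    by (simp_all add: D_def)
  have sK: "summable (\<lambda>n. ip (T K x n) (T K x n))" for x
    unfolding TK by (rule summable_ip_add[OF sH sD])
  note bounds = norm_frame_sum_bounds[OF B w, unfolded ft, OF sH, folded m_def]
  \<comment> \<open>The aim is (1 + 1/d) R < m, that is R/d < m - R. The summand 1 keeps
    \<open>d\<close> positive when R = 0 and makes the inequality strict.\<close>
  define d where "d = (R + 1) / (m - R)"
  have "m > R" using Rm by (simp add: R_def)
  then have "d > 0" using \<open>R \<ge> 0\<close> by (simp add: d_def)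
  have "R / d = R * (m - R) / (R + 1)" by (simp add: d_def)
  also have "\<dots> < m - R" using \<open>m > R\<close> \<open>R \<ge> 0\<close> by (simp add: field_simps)
  finally have "R / d < m - R" .
  define e where "e = m - (1 + 1/d) * R"
  define c where "c = e / (1 + d)"
  have "e > 0" using \<open>R / d < m - R\<close> by (simp add: e_def algebra_simps)
  then have "c > 0" using \<open>d > 0\<close> by (simp add: c_def)
  show ?thesis
  proof (rule star_fusion_frame_of_norm_bounds[OF w K _ \<open>c > 0\<close>, unfolded ft])
    fix x
    let ?H = "\<Sum>n. ip (T H x n) (T H x n)" and ?K = "\<Sum>n. ip (T K x n) (T K x n)"
    have "m * (norm x)\<^sup>2 \<le> norm ?H" by (rule bounds(1))
    also have "\<dots> \<le> (1 + d) * norm ?K + (1 + 1/d) * norm (\<Sum>n. ip (D x n) (D x n))"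
      unfolding TH mD(2)[symmetric] by (rule norm_suminf_ip_add_le[OF sK mD(1) \<open>d > 0\<close>])
    also have "\<dots> \<le> (1 + d) * norm ?K + (1 + 1/d) * (R * (norm x)\<^sup>2)"
      using ND \<open>d > 0\<close> by (intro add_left_mono mult_left_mono) auto
    finally have "e * (norm x)\<^sup>2 \<le> (1 + d) * norm ?K" by (simp add: e_def left_diff_distrib mult.assoc)
    then show "c * (norm x)\<^sup>2 \<le> norm ?K"
      using \<open>d > 0\<close> by (simp add: c_def pos_divide_le_eq mult.commute)
    \<comment> \<open>Any positive parameter serves for the upper bound; here it is 1.\<close>
    have "norm ?K \<le> (1 + 1) * norm ?H + (1 + 1/1) * norm (\<Sum>n. ip (D x n) (D x n))"
      unfolding TK by (rule norm_suminf_ip_add_le[OF sH sD]) simp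
    also have "\<dots> \<le> (1 + 1) * ((norm B)\<^sup>2 * (norm x)\<^sup>2) + (1 + 1/1) * (R * (norm x)\<^sup>2)"
      using ND bounds(2) by (intro add_mono mult_left_mono) auto
    finally show "norm ?K \<le> (2 * (norm B)\<^sup>2 + 2 * R) * (norm x)\<^sup>2" by (simp add: algebra_simps)
  qed (rule sK)
qed

end

section \<open>Hoelder's inequality and the three criteria\<close>

lemma summable_Hoelder:
  fixes a b :: "nat \<Rightarrow> real"
  assumes pq: "p > 1" "q > 1" "1/p + 1/q = 1" and nn: "\<And>n. a n \<ge> 0" "\<And>n. b n \<ge> 0"
    and sa: "summable (\<lambda>n. a n powr p)" and sb: "summable (\<lambda>n. b n powr q)"
  shows "summable (\<lambda>n. a n * b n)"
    "(\<Sum>n. a n * b n) \<le> (\<Sum>n. a n powr p) powr (1/p) * (\<Sum>n. b n powr q) powr (1/q)"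
proof -
  have "summable (\<lambda>n. a n powr p / p + b n powr q / q)"
    by (intro summable_add summable_divide sa sb)
  then show s: "summable (\<lambda>n. a n * b n)"
    by (rule summable_comparison_test'[where N = 0])
       (use Youngs_inequality[OF pq nn(1) nn(2)] nn in simp)
  define A where "A = (\<Sum>n. a n powr p)"
  define B where "B = (\<Sum>n. b n powr q)"
  have "A \<ge> 0" "B \<ge> 0" unfolding A_def B_def by (simp_all add: suminf_nonneg sa sb)
  show "(\<Sum>n. a n * b n) \<le> A powr (1/p) * B powr (1/q)"
  \<comment> \<open>If one of the sums is 0, every product vanishes; otherwise both sequences can be
    normalised.\<close>
  proof (cases "A = 0 \<or> B = 0")
    case True
    have z: "a n * b n = 0" for n
    proof -
      have "a n powr p = 0 \<or> b n powr q = 0"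
        using True suminf_eq_zero_iff[OF sa] suminf_eq_zero_iff[OF sb] by (auto simp: A_def B_def)
      then show ?thesis by auto
    qed
    show ?thesis unfolding z by simp
  next
    case False
    then have "A > 0" "B > 0" using \<open>A \<ge> 0\<close> \<open>B \<ge> 0\<close> by auto
    define M where "M = A powr (1/p) * B powr (1/q)"
    have "M > 0" using \<open>A > 0\<close> \<open>B > 0\<close> by (simp add: M_def)
    \<comment> \<open>Young's inequality for the normalised sequences; the right-hand sides then sum
      to 1/p + 1/q = 1.\<close>
    have "a n * b n / M \<le> a n powr p / A / p + b n powr q / B / q" for n
      using Youngs_inequality[OF pq, of "a n / A powr (1/p)" "b n / B powr (1/q)"] nn[of n] pq
        \<open>A > 0\<close> \<open>B > 0\<close> by (simp add: powr_divide powr_powr M_def)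
    then have "(\<Sum>n. a n * b n / M) \<le> (\<Sum>n. a n powr p / A / p + b n powr q / B / q)"
      by (intro suminf_le summable_add summable_divide sa sb s)
    also have "\<dots> = A / A / p + B / B / q"
      using summable_sums[OF sa, folded A_def] summable_sums[OF sb, folded B_def]
      by (intro sums_unique[symmetric] sums_add sums_divide)
    also have "\<dots> = 1" using \<open>A > 0\<close> \<open>B > 0\<close> pq(3) by simp
    finally have "(\<Sum>n. a n * b n) / M \<le> 1" unfolding suminf_divide[OF s, of M] .
    then show ?thesis using \<open>M > 0\<close> by (simp add: M_def[symmetric] pos_divide_le_eq)
  qed
qed

lemma series_less_mono:
  assumes "series_less b r" "\<And>n. 0 \<le> a n" "\<And>n. a n \<le> b n" shows "series_less a r"
proof -
  have "summable a"
    by (rule summable_comparison_test'[where g = b and N = 0]) (use assms in \<open>auto simp: series_less_def\<close>)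
  then show ?thesis using suminf_le[of a b] assms by (fastforce simp: series_less_def)
qed

theorem corollary5p2:
  fixes act :: "'a::unital_cstar_algebra \<Rightarrow> 'h::banach \<Rightarrow> 'h"
    and ip :: "'h \<Rightarrow> 'h \<Rightarrow> 'a"
    and \<omega> :: "nat \<Rightarrow> 'a"
    and H K :: "nat \<Rightarrow> 'h set"
    and A :: 'a
  assumes "hilbert_module act ip"
    and "weight \<omega>"
    and "\<And>n. H n \<in> Comp act ip"
    and "\<And>n. K n \<in> Comp act ip"
    and "star_fusion_frame act ip H \<omega>"
    and "lower_bound act ip H \<omega> A"
  shows
    "(series_less (\<lambda>n. (norm (\<omega> n))\<^sup>2 * (angle ip (H n) (K n))\<^sup>2)
        (norm (alg_inverse A) powi (-2))
      \<longrightarrow> star_fusion_frame act ip K \<omega>)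
     \<and>
     (bounded (range \<omega>) \<and>
      series_less (\<lambda>n. (angle ip (H n) (K n))\<^sup>2)
        ((norm (alg_inverse A) powi (-1) / sup_norm \<omega>)\<^sup>2)
      \<longrightarrow> star_fusion_frame act ip K \<omega>)
     \<and>
     (\<forall>p::real. p > 1 \<and> sq_norms \<omega> \<in> lp_space p \<and>
      series_less (\<lambda>n. angle ip (H n) (K n) powr (2 * p / (p - 1)))
        ((norm (alg_inverse A) powi (-2) / lp_norm p (sq_norms \<omega>)) powr (p / (p - 1)))
      \<longrightarrow> star_fusion_frame act ip K \<omega>)"
proof -
  interpret hilbert_module act ip by (rule assms(1))
  let ?\<theta> = "\<lambda>n. angle ip (H n) (K n)" and ?N = "norm (alg_inverse A)"
  obtain B where B: "fusion_bounds act ip H \<omega> A B" using assms(6) by (auto simp: lower_bound_def)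
  \<comment> \<open>This bound does not involve x; the vector 0 is an arbitrary choice.\<close>
  have N: "?N > 0"
    using norm_frame_sum_bounds(3)[OF B assms(2), of 0] assms(5) by (auto simp: star_fusion_frame_def)
  have \<theta>: "0 \<le> gap ip (H n) (K n)" "gap ip (H n) (K n) \<le> ?\<theta> n" for n
    using norm_orth_proj_diff_le_gap(2) gap_le_angle assms(3,4) by blast+
  then have \<theta>0: "0 \<le> ?\<theta> n" for n by (meson order_trans)
  have 1: "star_fusion_frame act ip K \<omega>"
    if "series_less (\<lambda>n. (norm (\<omega> n))\<^sup>2 * (?\<theta> n)\<^sup>2) (?N powi (- 2))"
  proof (rule star_fusion_frame_perturbation[OF assms(2-6)])
    show "series_less (\<lambda>n. (norm (\<omega> n))\<^sup>2 * (gap ip (H n) (K n))\<^sup>2) (?N powi (- 2))"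
      using that by (rule series_less_mono) (auto intro!: mult_left_mono power_mono \<theta>)
  qed
  have 2: "star_fusion_frame act ip K \<omega>"
    if bd: "bounded (range \<omega>)" and less: "series_less (\<lambda>n. (?\<theta> n)\<^sup>2) ((?N powi (- 1) / sup_norm \<omega>)\<^sup>2)"
  proof (rule 1, rule series_less_mono)
    let ?s = "sup_norm \<omega>"
    have "bdd_above (range (\<lambda>n. norm (\<omega> n)))"
      using bd by (simp add: bounded_iff bdd_above_def image_def) blast
    then have le: "norm (\<omega> n) \<le> ?s" for n unfolding sup_norm_def by (rule cSUP_upper2[OF _ UNIV_I order_refl])
    then show "(norm (\<omega> n))\<^sup>2 * (?\<theta> n)\<^sup>2 \<le> ?s\<^sup>2 * (?\<theta> n)\<^sup>2" for n
      by (intro mult_right_mono power_mono) auto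
    have sm: "summable (\<lambda>n. (?\<theta> n)\<^sup>2)" and lt: "(\<Sum>n. (?\<theta> n)\<^sup>2) < (?N powi (- 1) / ?s)\<^sup>2"
      using less by (simp_all add: series_less_def)
    have "0 \<le> (\<Sum>n. (?\<theta> n)\<^sup>2)" by (rule suminf_nonneg[OF sm]) simp
    \<comment> \<open>Division by 0 yields 0, so \<open>?s = 0\<close> would put a nonnegative sum
      strictly below 0.\<close>
    then have "?s \<noteq> 0" using lt by auto
    then have "?s\<^sup>2 > 0" by simp
    then have "?s\<^sup>2 * (\<Sum>n. (?\<theta> n)\<^sup>2) < ?s\<^sup>2 * (?N powi (- 1) / ?s)\<^sup>2"
      using lt by (rule mult_strict_left_mono[rotated])
    also have "\<dots> = ?N powi (- 2)"
      using \<open>?s \<noteq> 0\<close> N by (simp add: power_int_minus power_divide power_inverse)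
    finally show "series_less (\<lambda>n. ?s\<^sup>2 * (?\<theta> n)\<^sup>2) (?N powi (- 2))"
      using sm by (simp add: series_less_def suminf_mult summable_mult)
  qed simp
  have 3: "star_fusion_frame act ip K \<omega>"
    if p: "p > 1" and lp: "sq_norms \<omega> \<in> lp_space p"
      and less: "series_less (\<lambda>n. ?\<theta> n powr (2 * p / (p - 1)))
        ((?N powi (- 2) / lp_norm p (sq_norms \<omega>)) powr (p / (p - 1)))" for p
  proof (rule 1)
    \<comment> \<open>The conjugate exponent of \<open>p\<close>: the angles carry the exponent 2q,
      so their squares are the sequence to which Hoelder's inequality applies.\<close>
    define q where "q = p / (p - 1)"
    have q: "q > 1" "1/p + 1/q = 1" using p by (simp_all add: q_def field_simps)
    let ?L = "lp_norm p (sq_norms \<omega>)" and ?m = "?N powi (- 2)"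
    have "?m > 0" using N by simp
    have sa: "summable (\<lambda>n. ((norm (\<omega> n))\<^sup>2) powr p)" using lp by (simp add: lp_space_def sq_norms_def norm_power)
    have L: "?L = (\<Sum>n. ((norm (\<omega> n))\<^sup>2) powr p) powr (1/p)" by (simp add: lp_norm_def sq_norms_def norm_power)
    have eq: "?\<theta> n powr (2 * p / (p - 1)) = ((?\<theta> n)\<^sup>2) powr q" for n
    proof -
      have "(?\<theta> n)\<^sup>2 = ?\<theta> n powr 2" using \<theta>0[of n] by simp
      then show ?thesis by (simp add: powr_powr q_def)
    qed
    let ?B = "\<Sum>n. ((?\<theta> n)\<^sup>2) powr q"
    have sb: "summable (\<lambda>n. ((?\<theta> n)\<^sup>2) powr q)" and lt: "?B < (?m / ?L) powr q"
      using less unfolding eq q_def[symmetric] by (simp_all add: series_less_def)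
    have "?B \<ge> 0" by (rule suminf_nonneg[OF sb]) simp
    \<comment> \<open>If \<open>?L = 0\<close>, the quotient and its power are 0, again leaving a
      nonnegative sum below 0.\<close>
    then have "?L \<noteq> 0" using lt by auto
    then have "?L > 0" using L by (simp add: less_le)
    have "?B powr (1/q) < ((?m / ?L) powr q) powr (1/q)"
      using lt \<open>?B \<ge> 0\<close> q by (intro powr_less_mono2) auto
    then have "?B powr (1/q) < ?m / ?L"
      using q \<open>?m > 0\<close> \<open>?L > 0\<close> by (simp add: powr_powr)
    then have "?L * ?B powr (1/q) < ?m" using \<open>?L > 0\<close> by (simp add: field_simps)
    then show "series_less (\<lambda>n. (norm (\<omega> n))\<^sup>2 * (?\<theta> n)\<^sup>2) ?m"
      using summable_Hoelder[OF p q _ _ sa sb, folded L] by (auto simp: series_less_def)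
  qed
  show ?thesis using 1 2 3 by blast
qed

end
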